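(* Let $\mathcal{X}$ be a Banach space with a normalized basis $\mathfrak{X}=\{x_k\}_{k=1}^\infty$. Then the space $\mathcal{X}\oplus\ell^2$, endowed with the norm given by $\|x+y\|_{\mathcal{X}\oplus\ell^2}^2=\|x\|_{\mathcal{X}}^2+\|y\|_{\ell^2}^2$, has a quasi-greedy basis $\Psi=\{\psi_\lambda\}$ such that, moreover: (i) $\Psi$ is democratic, and there are constants $0<c_1\le c_2$ such that $c_1|\Lambda|^{1/2}\le\big\|\sum_{\lambda\in\Lambda}\psi_\lambda\big\|\le c_2|\Lambda|^{1/2}$ for every finite set $\Lambda$ of indices; (ii) if the basis $\mathfrak{X}$ is besselian, then so is $\Psi$; if $\mathfrak{X}$ is hilbertian, then so is $\Psi$; (iii) if the basis $\mathfrak{X}$ has the property that, for some $c>0$ and every $N=1,2,\ldots$, there exist a nonzero $x\in\mathcal{X}$ and a set $A\subset\{1,\ldots,N\}$ such that $$\|S_A x\|\ge c\,k_N(\mathfrak{X})\,\|x\|,$$ then there is a constant $c'>0$ such that $$k_N(\Psi)\ge c'\,k_{\log N}(\mathfrak{X}),\qquad N=2,3,\ldots$$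
   Context: A basis means a Schauder basis $\mathscr{B}=\{\mathbf{e}_j\}_{j=1}^\infty$ of a Banach space $\mathbb{X}$ (scalars in $\mathbb{C}$); normalized means $\|\mathbf{e}_j\|=1$ for all $j$. Every $x$ is written $x=\sum_j a_j(x)\mathbf{e}_j$. For $N\ge1$, $G_N(x)=\sum_{j\in\Lambda}a_j(x)\mathbf{e}_j$, where $\Lambda\subset\{1,2,\dots\}$ is any $N$-element set with $\min_{j\in\Lambda}|a_j(x)|\ge\max_{j\notin\Lambda}|a_j(x)|$. The basis is quasi-greedy if $\lim_{N\to\infty}\|x-G_N(x)\|=0$ for every $x$ and every choice of the $G_N$'s; equivalently, there is a constant $K$ with $\|G_N(x)\|\le K\|x\|$ for all $x$, all $N\ge1$ and all choices of $G_N$. The basis is democratic if there is $D$ with $\|\sum_{j\in A}\mathbf{e}_j\|\le D\|\sum_{j\in B}\mathbf{e}_j\|$ for all finite $A,B$ with $|A|=|B|$. For finite $A\subset\{1,2,\dots\}$, $S_A(x)=\sum_{j\in A}a_j(x)\mathbf{e}_j$. For real $t\ge0$, $k_t(\mathscr{B})=\sup_{|A|\le t}\|S_A\|$. The basis is besselian if there is $C$ with $\sum_j|a_j|^2\le C\|\sum_j a_j\mathbf{e}_j\|^2$ for all finitely supported scalar sequences $(a_j)$, and hilbertian if there is $C>0$ with $\sum_j|a_j|^2\ge C\|\sum_j a_j\mathbf{e}_j\|^2$ for all such sequences. *)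

theory Defs
  imports "HOL-Analysis.Analysis"
begin

section \<open>Complex Banach spaces\<close>

text \<open>
  The distribution only has real normed spaces.  A complex normed space is a real normed space
  with a scalar multiplication by complex numbers that extends the real one and for which the norm
  is homogeneous.
\<close>

class complex_normed_vector = real_normed_vector +
  fixes scaleC :: "complex \<Rightarrow> 'a \<Rightarrow> 'a" (infixr "*\<^sub>C" 75)
  assumes scaleC_add_right: "a *\<^sub>C (x + y) = a *\<^sub>C x + a *\<^sub>C y"
    and scaleC_add_left: "(a + b) *\<^sub>C x = a *\<^sub>C x + b *\<^sub>C x"
    and scaleC_scaleC: "a *\<^sub>C (b *\<^sub>C x) = (a * b) *\<^sub>C x"
    and scaleC_of_real: "complex_of_real r *\<^sub>C x = r *\<^sub>R x"
    and norm_scaleC: "norm (a *\<^sub>C x) = cmod a * norm x"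

class complex_banach = complex_normed_vector + complete_space

subclass (in complex_banach) banach ..

text \<open>
  The library norm on a product is \<open>norm (x, y) = sqrt ((norm x)\<^sup>2 + (norm y)\<^sup>2)\<close>, so that
  \<open>'a \<times> 'b\<close> is the Hilbertian direct sum.
\<close>

instantiation prod :: (complex_normed_vector, complex_normed_vector) complex_normed_vector
begin

definition scaleC_prod_def: "c *\<^sub>C z = (c *\<^sub>C fst z, c *\<^sub>C snd z)"

instance
proof
  fix a b :: complex and r :: real and x y :: "'a \<times> 'b"
  show "a *\<^sub>C (x + y) = a *\<^sub>C x + a *\<^sub>C y"
    unfolding scaleC_prod_def by (rule prod_eqI) (simp_all only: fst_add snd_add fst_conv snd_conv scaleC_add_right)
  show "(a + b) *\<^sub>C x = a *\<^sub>C x + b *\<^sub>C x"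
    unfolding scaleC_prod_def by (rule prod_eqI) (simp_all only: fst_add snd_add fst_conv snd_conv scaleC_add_left)
  show "a *\<^sub>C (b *\<^sub>C x) = (a * b) *\<^sub>C x"
    unfolding scaleC_prod_def by (simp only: fst_conv snd_conv scaleC_scaleC)
  show "complex_of_real r *\<^sub>C x = r *\<^sub>R x"
    unfolding scaleC_prod_def scaleR_prod_def by (simp only: scaleC_of_real)
  have "(norm (a *\<^sub>C x))\<^sup>2 = (cmod a * norm x)\<^sup>2"
    unfolding scaleC_prod_def norm_prod_def
    by (simp add: norm_scaleC power_mult_distrib distrib_left)
  then show "norm (a *\<^sub>C x) = cmod a * norm x"
    by (rule power2_eq_imp_eq) auto
qed

end

instance prod :: (complex_banach, complex_banach) complex_banach ..


section \<open>The Hilbert space of square-summable sequences\<close>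

definition sq_summable :: "(nat \<Rightarrow> complex) \<Rightarrow> bool" where
  "sq_summable f \<longleftrightarrow> summable (\<lambda>n. (cmod (f n))\<^sup>2)"

lemma sq_summable_add:
  assumes "sq_summable f" "sq_summable g"
  shows "sq_summable (\<lambda>n. f n + g n)"
  unfolding sq_summable_def
proof (rule summable_comparison_test')
  show "summable (\<lambda>n. 2 * (cmod (f n))\<^sup>2 + 2 * (cmod (g n))\<^sup>2)"
    using assms unfolding sq_summable_def by (intro summable_add summable_mult)
  fix n :: nat
  have "(cmod (f n + g n))\<^sup>2 \<le> (cmod (f n) + cmod (g n))\<^sup>2"
    by (simp add: norm_triangle_ineq power_mono)
  also have "\<dots> \<le> 2 * (cmod (f n))\<^sup>2 + 2 * (cmod (g n))\<^sup>2"
    using zero_le_power2[of "cmod (f n) - cmod (g n)"] by (simp add: power2_eq_square algebra_simps)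
  finally show "norm ((cmod (f n + g n))\<^sup>2) \<le> 2 * (cmod (f n))\<^sup>2 + 2 * (cmod (g n))\<^sup>2"
    by simp
qed

lemma sq_summable_scale:
  assumes "sq_summable f"
  shows "sq_summable (\<lambda>n. c * f n)"
  using assms unfolding sq_summable_def by (simp add: norm_mult power_mult_distrib summable_mult)

lemma sq_summable_uminus: "sq_summable f \<Longrightarrow> sq_summable (\<lambda>n. - f n)"
  by (simp add: sq_summable_def)

lemma sq_summable_diff: "sq_summable f \<Longrightarrow> sq_summable g \<Longrightarrow> sq_summable (\<lambda>n. f n - g n)"
  using sq_summable_add[OF _ sq_summable_uminus, of f g] by simp

lemma summable_inner_sq:
  assumes "sq_summable f" "sq_summable g"
  shows "summable (\<lambda>n. f n \<bullet> g n)"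
proof (rule summable_comparison_test')
  show "summable (\<lambda>n. (cmod (f n))\<^sup>2 + (cmod (g n))\<^sup>2)"
    using assms unfolding sq_summable_def by (rule summable_add)
  fix n :: nat
  have "\<bar>f n \<bullet> g n\<bar> \<le> cmod (f n) * cmod (g n)"
    by (rule Cauchy_Schwarz_ineq2)
  also have "\<dots> \<le> (cmod (f n))\<^sup>2 + (cmod (g n))\<^sup>2"
    using sum_squares_bound[of "cmod (f n)" "cmod (g n)"]
      mult_nonneg_nonneg[OF norm_ge_zero norm_ge_zero, of "f n" "g n"] by linarith
  finally show "norm (f n \<bullet> g n) \<le> (cmod (f n))\<^sup>2 + (cmod (g n))\<^sup>2"
    by simp
qed

typedef ell2 = "{f :: nat \<Rightarrow> complex. sq_summable f}"
  morphisms ell2_nth Abs_ell2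
  by (rule exI[of _ "\<lambda>_. 0"]) (simp add: sq_summable_def)

setup_lifting type_definition_ell2

lemma sq_summable_ell2_nth: "sq_summable (ell2_nth x)"
  using ell2_nth by auto

lemma ell2_eqI: "(\<And>n. ell2_nth x n = ell2_nth y n) \<Longrightarrow> x = y"
  by (metis ell2_nth_inject ext)

instantiation ell2 :: real_vector
begin

lift_definition zero_ell2 :: ell2 is "\<lambda>_. 0" by (simp add: sq_summable_def)
lift_definition plus_ell2 :: "ell2 \<Rightarrow> ell2 \<Rightarrow> ell2" is "\<lambda>f g n. f n + g n"
  by (rule sq_summable_add)
lift_definition uminus_ell2 :: "ell2 \<Rightarrow> ell2" is "\<lambda>f n. - f n"
  by (rule sq_summable_uminus)
lift_definition minus_ell2 :: "ell2 \<Rightarrow> ell2 \<Rightarrow> ell2" is "\<lambda>f g n. f n - g n"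
  by (rule sq_summable_diff)
lift_definition scaleR_ell2 :: "real \<Rightarrow> ell2 \<Rightarrow> ell2" is "\<lambda>r f n. complex_of_real r * f n"
  by (rule sq_summable_scale)

instance
  by standard (transfer; simp add: fun_eq_iff algebra_simps)+

end

text \<open>
  The real inner product is only an intermediate step here; it provides the norm axioms for the
  usual norm of \<open>\<ell>\<^sup>2\<close>.
\<close>

instantiation ell2 :: real_inner
begin

lift_definition norm_ell2 :: "ell2 \<Rightarrow> real" is "\<lambda>f. sqrt (\<Sum>n. (cmod (f n))\<^sup>2)" .
lift_definition inner_ell2 :: "ell2 \<Rightarrow> ell2 \<Rightarrow> real" is "\<lambda>f g. \<Sum>n. f n \<bullet> g n" .

definition dist_ell2 :: "ell2 \<Rightarrow> ell2 \<Rightarrow> real" where "dist_ell2 x y = norm (x - y)"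
definition sgn_ell2 :: "ell2 \<Rightarrow> ell2" where "sgn_ell2 x = x /\<^sub>R norm x"
definition uniformity_ell2 :: "(ell2 \<times> ell2) filter" where
  "uniformity_ell2 = (INF e\<in>{0 <..}. principal {(x, y). dist x y < e})"
definition open_ell2 :: "ell2 set \<Rightarrow> bool" where
  "open_ell2 U \<longleftrightarrow> (\<forall>x\<in>U. \<forall>\<^sub>F (x', y) in uniformity. x' = x \<longrightarrow> y \<in> U)"

instance
proof
  fix x y z :: ell2 and r :: real and U :: "ell2 set"
  show "dist x y = norm (x - y)" by (rule dist_ell2_def)
  show "sgn x = x /\<^sub>R norm x" by (rule sgn_ell2_def)
  show "uniformity = (INF e\<in>{0 <..}. principal {(x::ell2, y). dist x y < e})"
    by (rule uniformity_ell2_def)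
  show "open U \<longleftrightarrow> (\<forall>x\<in>U. \<forall>\<^sub>F (x', y) in uniformity. x' = x \<longrightarrow> y \<in> U)"
    by (rule open_ell2_def)
  show "x \<bullet> y = y \<bullet> x"
    by transfer (simp add: inner_commute)
  show "(x + y) \<bullet> z = x \<bullet> z + y \<bullet> z"
  proof transfer
    fix f g h assume fgh: "sq_summable f" "sq_summable g" "sq_summable h"
    show "(\<Sum>n. (f n + g n) \<bullet> h n) = (\<Sum>n. f n \<bullet> h n) + (\<Sum>n. g n \<bullet> h n)"
      unfolding inner_add_left using fgh by (intro suminf_add[symmetric] summable_inner_sq)
  qed
  show "(r *\<^sub>R x) \<bullet> y = r * (x \<bullet> y)"
  proof transfer
    fix r f g assume "sq_summable f" "sq_summable g"
    then show "(\<Sum>n. (complex_of_real r * f n) \<bullet> g n) = r * (\<Sum>n. f n \<bullet> g n)"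
      unfolding scaleR_conv_of_real[symmetric] inner_scaleR_left
      by (intro suminf_mult summable_inner_sq)
  qed
  show "0 \<le> x \<bullet> x"
    by transfer (auto intro!: suminf_nonneg summable_inner_sq)
  show "x \<bullet> x = 0 \<longleftrightarrow> x = 0"
  proof transfer
    fix f assume "sq_summable f"
    then show "((\<Sum>n. f n \<bullet> f n) = 0) = (f = (\<lambda>_. 0))"
      by (subst suminf_eq_zero_iff) (auto intro: summable_inner_sq)
  qed
  show "norm x = sqrt (x \<bullet> x)"
    by transfer (simp only: power2_norm_eq_inner)
qed

end

instantiation ell2 :: complex_normed_vector
begin

lift_definition scaleC_ell2 :: "complex \<Rightarrow> ell2 \<Rightarrow> ell2" is "\<lambda>c f n. c * f n"
  by (rule sq_summable_scale)

instance
proof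
  fix a b :: complex and r :: real and x y :: ell2
  show "a *\<^sub>C (x + y) = a *\<^sub>C x + a *\<^sub>C y" by transfer (simp add: algebra_simps)
  show "(a + b) *\<^sub>C x = a *\<^sub>C x + b *\<^sub>C x" by transfer (simp add: algebra_simps)
  show "a *\<^sub>C (b *\<^sub>C x) = (a * b) *\<^sub>C x" by transfer (simp add: algebra_simps)
  show "complex_of_real r *\<^sub>C x = r *\<^sub>R x" by transfer simp
  show "norm (a *\<^sub>C x) = cmod a * norm x"
  proof transfer
    fix a f assume "sq_summable f"
    then have "(\<Sum>n. (cmod (a * f n))\<^sup>2) = (cmod a)\<^sup>2 * (\<Sum>n. (cmod (f n))\<^sup>2)"
      unfolding norm_mult power_mult_distrib sq_summable_def by (rule suminf_mult)
    then show "sqrt (\<Sum>n. (cmod (a * f n))\<^sup>2) = cmod a * sqrt (\<Sum>n. (cmod (f n))\<^sup>2)"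
      by (simp add: real_sqrt_mult)
  qed
qed

end

lemma norm_ell2_power2: "(norm x)\<^sup>2 = (\<Sum>n. (cmod (ell2_nth x n))\<^sup>2)"
  using sq_summable_ell2_nth[of x] unfolding sq_summable_def
  by (simp add: norm_ell2.rep_eq suminf_nonneg)

lemma sum_le_norm_ell2:
  assumes "finite F"
  shows "(\<Sum>n\<in>F. (cmod (ell2_nth x n))\<^sup>2) \<le> (norm x)\<^sup>2"
  using sq_summable_ell2_nth[of x] assms unfolding sq_summable_def norm_ell2_power2
  by (intro sum_le_suminf) auto

lemma norm_ell2_nth_le: "cmod (ell2_nth x n) \<le> norm x"
  using sum_le_norm_ell2[of "{n}" x] by (simp add: power2_le_iff_abs_le)

instance ell2 :: complex_banach
proof
  fix X :: "nat \<Rightarrow> ell2"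
  assume X: "Cauchy X"
  have "Cauchy (\<lambda>m. ell2_nth (X m) n)" for n
  proof (rule CauchyI)
    fix e :: real assume "0 < e"
    then obtain M where "\<And>m k. m \<ge> M \<Longrightarrow> k \<ge> M \<Longrightarrow> norm (X m - X k) < e"
      using CauchyD[OF X] by blast
    moreover have "cmod (ell2_nth (X m) n - ell2_nth (X k) n) \<le> norm (X m - X k)" for m k
      using norm_ell2_nth_le[of "X m - X k" n] by (simp add: minus_ell2.rep_eq)
    ultimately show "\<exists>M. \<forall>m\<ge>M. \<forall>k\<ge>M. cmod (ell2_nth (X m) n - ell2_nth (X k) n) < e"
      by (meson le_less_trans)
  qed
  then obtain l where l: "\<And>n. (\<lambda>m. ell2_nth (X m) n) \<longlonglongrightarrow> l n"
    unfolding Cauchy_convergent_iff convergent_def by metis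
  have bound: "\<exists>M. \<forall>m\<ge>M. \<forall>k. (\<Sum>n<k. (cmod (ell2_nth (X m) n - l n))\<^sup>2) \<le> e\<^sup>2" if "0 < e" for e
  proof -
    obtain M where M: "\<And>m k. m \<ge> M \<Longrightarrow> k \<ge> M \<Longrightarrow> norm (X m - X k) < e"
      using CauchyD[OF X \<open>0 < e\<close>] by blast
    have "(\<Sum>n<k. (cmod (ell2_nth (X m) n - l n))\<^sup>2) \<le> e\<^sup>2" if "m \<ge> M" for m k
    proof (rule LIMSEQ_le_const2)
      show "(\<lambda>j. \<Sum>n<k. (cmod (ell2_nth (X m) n - ell2_nth (X j) n))\<^sup>2)
          \<longlonglongrightarrow> (\<Sum>n<k. (cmod (ell2_nth (X m) n - l n))\<^sup>2)"
        by (intro tendsto_intros l)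
      have "(\<Sum>n<k. (cmod (ell2_nth (X m) n - ell2_nth (X j) n))\<^sup>2) \<le> e\<^sup>2" if "j \<ge> M" for j
      proof -
        have "(\<Sum>n<k. (cmod (ell2_nth (X m) n - ell2_nth (X j) n))\<^sup>2) \<le> (norm (X m - X j))\<^sup>2"
          using sum_le_norm_ell2[of "{..<k}" "X m - X j"] by (simp add: minus_ell2.rep_eq)
        also have "\<dots> \<le> e\<^sup>2"
          using M[OF \<open>m \<ge> M\<close> that] by (intro power_mono) auto
        finally show ?thesis .
      qed
      then show "\<exists>N. \<forall>j\<ge>N. (\<Sum>n<k. (cmod (ell2_nth (X m) n - ell2_nth (X j) n))\<^sup>2) \<le> e\<^sup>2"
        by blast
    qed
    then show ?thesis by blast
  qed
  have sq: "sq_summable (\<lambda>n. ell2_nth (X m) n - l n)"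
    if "\<forall>k. (\<Sum>n<k. (cmod (ell2_nth (X m) n - l n))\<^sup>2) \<le> e\<^sup>2" for m e
    unfolding sq_summable_def using that by (intro summableI_nonneg_bounded[of _ "e\<^sup>2"]) auto
  obtain M where "\<forall>k. (\<Sum>n<k. (cmod (ell2_nth (X M) n - l n))\<^sup>2) \<le> 1\<^sup>2"
    using bound[of 1] by auto
  from sq_summable_diff[OF sq_summable_ell2_nth[of "X M"] sq[OF this]]
  have "sq_summable l" by simp
  then have L: "ell2_nth (Abs_ell2 l) = l"
    by (simp add: Abs_ell2_inverse)
  have "X \<longlonglongrightarrow> Abs_ell2 l"
  proof (rule LIMSEQ_I)
    fix e :: real assume "0 < e"
    then obtain M where
      M: "\<And>m k. m \<ge> M \<Longrightarrow> (\<Sum>n<k. (cmod (ell2_nth (X m) n - l n))\<^sup>2) \<le> (e/2)\<^sup>2"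
      using bound[of "e/2"] by auto
    have "norm (X m - Abs_ell2 l) < e" if "m \<ge> M" for m
    proof -
      have "sq_summable (\<lambda>n. ell2_nth (X m) n - l n)"
        using sq M[OF that] by blast
      then have "(norm (X m - Abs_ell2 l))\<^sup>2 \<le> (e/2)\<^sup>2"
        unfolding norm_ell2_power2 sq_summable_def
        using M[OF that] by (intro suminf_le_const) (auto simp: minus_ell2.rep_eq L)
      then have "norm (X m - Abs_ell2 l) \<le> e/2"
        using \<open>0 < e\<close> by (simp add: power2_le_iff_abs_le)
      then show ?thesis using \<open>0 < e\<close> by simp
    qed
    then show "\<exists>M. \<forall>m\<ge>M. norm (X m - Abs_ell2 l) < e" by blast
  qed
  then show "convergent X" by (rule convergentI)
qed


section \<open>Bases\<close>

text \<open>
  Sequences are indexed from \<open>0\<close>: the vector \<open>e j\<close> is the \<open>(j+1)\<close>-st basis vector, and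
  \<open>{..<N}\<close> plays the role of \<open>{1, \<dots>, N}\<close>.
\<close>

definition schauder_basis :: "(nat \<Rightarrow> 'a::complex_banach) \<Rightarrow> bool" where
  "schauder_basis e \<longleftrightarrow> (\<forall>x. \<exists>!a::nat \<Rightarrow> complex. (\<lambda>j. a j *\<^sub>C e j) sums x)"

definition coeffs :: "(nat \<Rightarrow> 'a::complex_banach) \<Rightarrow> 'a \<Rightarrow> nat \<Rightarrow> complex" where
  "coeffs e x = (THE a. (\<lambda>j. a j *\<^sub>C e j) sums x)"

definition basis_proj :: "(nat \<Rightarrow> 'a::complex_banach) \<Rightarrow> nat set \<Rightarrow> 'a \<Rightarrow> 'a" where
  "basis_proj e A x = (\<Sum>j\<in>A. coeffs e x j *\<^sub>C e j)"

definition greedy_set :: "(nat \<Rightarrow> 'a::complex_banach) \<Rightarrow> 'a \<Rightarrow> nat \<Rightarrow> nat set \<Rightarrow> bool" where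
  "greedy_set e x N \<Lambda> \<longleftrightarrow> finite \<Lambda> \<and> card \<Lambda> = N \<and>
     (\<forall>j\<in>\<Lambda>. \<forall>i. i \<notin> \<Lambda> \<longrightarrow> cmod (coeffs e x i) \<le> cmod (coeffs e x j))"

text \<open>Here \<open>\<Lambda>\<close> is the choice of a greedy set \<open>\<Lambda> N\<close> for every \<open>N\<close>, with \<open>G\<^sub>N x = basis_proj e (\<Lambda> N) x\<close>.\<close>

definition quasi_greedy :: "(nat \<Rightarrow> 'a::complex_banach) \<Rightarrow> bool" where
  "quasi_greedy e \<longleftrightarrow>
     (\<forall>x \<Lambda>. (\<forall>N\<ge>1. greedy_set e x N (\<Lambda> N)) \<longrightarrow>
        (\<lambda>N. norm (x - basis_proj e (\<Lambda> N) x)) \<longlonglongrightarrow> 0)"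

definition democratic :: "(nat \<Rightarrow> 'a::complex_banach) \<Rightarrow> bool" where
  "democratic e \<longleftrightarrow>
     (\<exists>D. \<forall>A B. finite A \<and> finite B \<and> card A = card B \<longrightarrow>
        norm (\<Sum>j\<in>A. e j) \<le> D * norm (\<Sum>j\<in>B. e j))"

definition besselian :: "(nat \<Rightarrow> 'a::complex_banach) \<Rightarrow> bool" where
  "besselian e \<longleftrightarrow>
     (\<exists>C. \<forall>a. finite {j. a j \<noteq> 0} \<longrightarrow>
        (\<Sum>j | a j \<noteq> 0. (cmod (a j))\<^sup>2) \<le> C * (norm (\<Sum>j | a j \<noteq> 0. a j *\<^sub>C e j))\<^sup>2)"

definition hilbertian :: "(nat \<Rightarrow> 'a::complex_banach) \<Rightarrow> bool" where
  "hilbertian e \<longleftrightarrow>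
     (\<exists>C>0. \<forall>a. finite {j. a j \<noteq> 0} \<longrightarrow>
        (\<Sum>j | a j \<noteq> 0. (cmod (a j))\<^sup>2) \<ge> C * (norm (\<Sum>j | a j \<noteq> 0. a j *\<^sub>C e j))\<^sup>2)"

text \<open>
  The supremum is taken in the extended reals, where it is meaningful for every basis; it is
  infinite only if the operators in question are not uniformly bounded.  Each of them is bounded
  when \<open>e\<close> is a Schauder basis, so that \<^const>\<open>onorm\<close> is then its operator norm.
\<close>

definition cond_const :: "(nat \<Rightarrow> 'a::complex_banach) \<Rightarrow> real \<Rightarrow> ereal" where
  "cond_const e t = (SUP A\<in>{A. finite A \<and> real (card A) \<le> t}. ereal (onorm (basis_proj e A)))"

end

theory Submission
  imports Defs
begin

text \<open>
  The basis is made of dyadic blocks.  The vectors of level \<open>k\<close> are obtained from \<open>X k\<close> and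
  \<open>2 ^ k - 1\<close> fresh unit vectors of \<open>\<ell>\<^sup>2\<close> by a unitary matrix of size \<open>2 ^ k\<close> with constant first
  column, so each of them has the component \<open>X k / sqrt (2 ^ k)\<close> in the first summand.  With the
  normalised block sums \<open>b k = (\<Sum>m\<in>block k. c m) / sqrt (2 ^ k)\<close>, unitarity gives
  (\<open>norm_sum_psi_power2\<close>)
  \<open>(norm (\<Sum>m. c m *\<^sub>C psi X m))\<^sup>2 = (norm (\<Sum>k. b k *\<^sub>C X k))\<^sup>2 + (\<Sum>m. (cmod (c m))\<^sup>2) - (\<Sum>k. (cmod (b k))\<^sup>2)\<close>,
  from which the besselian and hilbertian properties are inherited at once, and
  (\<open>norm_sum_psi_le\<close>) an upper bound by \<open>\<Sum>m. cmod (c m) / sqrt (2 ^ level m)\<close> plus the \<open>\<ell>\<^sup>2\<close> norm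
  of \<open>c\<close>, whatever the basis \<open>X\<close> is.

  Why quasi-greedy (\<open>thresholding_approximates\<close>): a coefficient of a vector \<open>z\<close> at level \<open>k\<close> is
  the sum of a coefficient of \<open>fst z\<close> divided by \<open>sqrt (2 ^ k)\<close> and a square-summable
  fluctuation.  For a small threshold \<open>t\<close> take \<open>K\<close> such that \<open>t * sqrt (2 ^ K)\<close> is about \<open>\<delta>\<close>.  Below
  level \<open>K\<close> all rejected coefficients together have norm of order \<open>\<delta>\<close>, by summing a geometric series.
  From level \<open>K\<close> on, the first part is at most \<open>t / 2\<close>, so the selected coefficients are dominated by the
  tail of the fluctuation.  Hence the greedy sum is close to the partial sum up to level \<open>K\<close>.

  Why democratic: the same splitting bounds the norm of \<open>\<Sum>m\<in>\<Lambda>. psi X m\<close> from above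
  (\<open>norm_sum_psi_indicator_le\<close>).  From below (\<open>norm_sum_psi_indicator_ge\<close>), the sparsely filled
  blocks are seen in \<open>\<ell>\<^sup>2\<close>, and the well filled ones through the coefficient functionals of \<open>X\<close>.
  This uses that these functionals are uniformly bounded, which is Banach's theorem on
  Schauder bases (\<open>schauder_partial_sums_bounded\<close>).

  Why conditional: the sum of a block is \<open>(sqrt (2 ^ k) *\<^sub>R X k, 0)\<close>.  Projections on unions of blocks
  therefore act on \<open>(x, 0)\<close> like projections along \<open>X\<close> (\<open>basis_proj_psi_blocks\<close>), and the blocks
  below level \<open>L\<close> have \<open>2 ^ L - 1\<close> elements, whence the logarithm (\<open>cond_const_psi_ge\<close>).
\<close>

section \<open>Schauder bases of complex Banach spaces\<close>

lemma bounded_linear_scaleC_right: "bounded_linear (\<lambda>x::'a::complex_normed_vector. a *\<^sub>C x)"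
proof (rule bounded_linear_intro)
  show "a *\<^sub>C (r *\<^sub>R x) = r *\<^sub>R (a *\<^sub>C x)" for r and x :: 'a
    by (simp flip: scaleC_of_real add: scaleC_scaleC mult.commute)
  show "norm (a *\<^sub>C x) \<le> norm x * cmod a" for x :: 'a
    by (simp add: norm_scaleC mult.commute)
qed (rule scaleC_add_right)

lemma bounded_linear_scaleC_left: "bounded_linear (\<lambda>a. a *\<^sub>C (x::'a::complex_normed_vector))"
proof (rule bounded_linear_intro)
  show "(r *\<^sub>R a) *\<^sub>C x = r *\<^sub>R (a *\<^sub>C x)" for r a
    by (simp flip: scaleC_of_real add: scaleC_scaleC scaleR_conv_of_real)
  show "norm (a *\<^sub>C x) \<le> norm a * norm x" for a
    by (simp add: norm_scaleC)
qed (rule scaleC_add_left)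

lemmas scaleC_zero_left [simp] = linear_0[OF bounded_linear.linear[OF bounded_linear_scaleC_left]]
lemmas scaleC_zero_right [simp] = linear_0[OF bounded_linear.linear[OF bounded_linear_scaleC_right]]
lemmas scaleC_diff_left = linear_diff[OF bounded_linear.linear[OF bounded_linear_scaleC_left]]
lemmas scaleC_sum_left = linear_sum[OF bounded_linear.linear[OF bounded_linear_scaleC_left]]

lemma scaleC_one [simp]: "1 *\<^sub>C x = x"
  using scaleC_of_real[of 1 x] by simp

lemma coeffs_sums:
  assumes "schauder_basis e"
  shows "(\<lambda>j. coeffs e x j *\<^sub>C e j) sums x"
proof -
  have "\<exists>!a. (\<lambda>j. a j *\<^sub>C e j) sums x" using assms by (auto simp: schauder_basis_def)
  from theI'[OF this] show ?thesis by (simp add: coeffs_def)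
qed

lemma coeffs_eqI:
  assumes "schauder_basis e" "(\<lambda>j. a j *\<^sub>C e j) sums x"
  shows "coeffs e x = a"
  using assms coeffs_sums[OF assms(1), of x] unfolding schauder_basis_def by blast

lemma coeffs_add:
  assumes "schauder_basis e"
  shows "coeffs e (x + y) j = coeffs e x j + coeffs e y j"
proof -
  have "(\<lambda>j. (coeffs e x j + coeffs e y j) *\<^sub>C e j) sums (x + y)"
    using sums_add[OF coeffs_sums[OF assms, of x] coeffs_sums[OF assms, of y]]
    by (simp add: scaleC_add_left)
  from coeffs_eqI[OF assms this] show ?thesis by simp
qed

lemma coeffs_scaleC:
  assumes "schauder_basis e"
  shows "coeffs e (a *\<^sub>C x) j = a * coeffs e x j"
proof -
  have "(\<lambda>j. (a * coeffs e x j) *\<^sub>C e j) sums (a *\<^sub>C x)"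
    using bounded_linear.sums[OF bounded_linear_scaleC_right coeffs_sums[OF assms, of x]]
    by (simp add: scaleC_scaleC)
  from coeffs_eqI[OF assms this] show ?thesis by simp
qed

lemma coeffs_scaleR:
  assumes "schauder_basis e"
  shows "coeffs e (r *\<^sub>R x) j = of_real r * coeffs e x j"
  using coeffs_scaleC[OF assms, of "of_real r" x j] by (simp add: scaleC_of_real)

lemma coeffs_diff:
  assumes "schauder_basis e"
  shows "coeffs e (x - y) j = coeffs e x j - coeffs e y j"
  using coeffs_add[OF assms, of "x - y" y j] by simp

lemma coeffs_zero:
  assumes "schauder_basis e"
  shows "coeffs e 0 j = 0"
  using coeffs_diff[OF assms, of 0 0 j] by simp

lemma schauder_basis_nonzero:
  assumes "schauder_basis e"
  shows "e j \<noteq> 0"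
proof
  assume "e j = 0"
  then have "(\<lambda>i. (if i = j then 1 else 0) *\<^sub>C e i) = (\<lambda>i. 0)" by auto
  then have "(\<lambda>i. (if i = j then 1 else 0) *\<^sub>C e i) sums 0" by (metis sums_zero)
  from fun_cong[OF coeffs_eqI[OF assms this], of j] coeffs_zero[OF assms, of j]
  show False by simp
qed

lemma basis_proj_linear:
  assumes "schauder_basis e"
  shows "basis_proj e A (x - y) = basis_proj e A x - basis_proj e A y"
    and "basis_proj e A (x + y) = basis_proj e A x + basis_proj e A y"
    and "basis_proj e A (r *\<^sub>R x) = r *\<^sub>R basis_proj e A x"
  using assms
  by (simp_all add: basis_proj_def coeffs_diff coeffs_add scaleC_diff_left
      scaleC_add_left sum_subtractf sum.distrib coeffs_scaleR scaleR_sum_right scaleC_of_real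
      flip: scaleC_scaleC)

text \<open>
  For each vector the partial sums of its expansion are bounded, so the space is the union of
  the sets of vectors whose partial sums are bounded by a given integer.  By Baire's theorem the
  closure of one of these sets has interior, and after rescaling every vector can be
  approximated with control of the partial sums.
\<close>
lemma approximants_with_bounded_partial_sums:
  assumes e: "schauder_basis (e :: nat \<Rightarrow> 'a::complex_banach)"
  obtains C where "C > 0"
    "\<And>y \<epsilon>. \<epsilon> > 0 \<Longrightarrow> \<exists>u. norm (y - u) \<le> \<epsilon> \<and> (\<forall>N. norm (basis_proj e {..<N} u) \<le> C * norm y)"
proof -
  define F where "F n = {x. \<forall>N. norm (basis_proj e {..<N} x) \<le> real n}" for n
  have F: "\<exists>n. x \<in> F n" for x
  proof -
    have "(\<lambda>N. basis_proj e {..<N} x) \<longlonglongrightarrow> x"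
      using coeffs_sums[OF e, of x] by (simp add: sums_def basis_proj_def)
    then have "Bseq (\<lambda>N. basis_proj e {..<N} x)"
      by (intro convergent_imp_Bseq convergentI)
    then obtain B where B: "\<And>N. norm (basis_proj e {..<N} x) \<le> B"
      by (auto simp: Bseq_def)
    obtain n where "B \<le> real n" using real_arch_simple by blast
    then have "x \<in> F n" using order_trans[OF B] by (auto simp: F_def)
    then show ?thesis by blast
  qed
  have "x \<in> (\<Union>n. closure (F n))" for x
    using F[of x] closure_subset by (meson UN_I UNIV_I subsetD)
  then have UNIV: "(\<Union>n. closure (F n)) = UNIV" by blast
  have "\<exists>n. interior (closure (F n)) \<noteq> {}"
  proof (rule ccontr)
    assume "\<not> ?thesis"
    then have "Met_TC.mtopology interior_of (\<Union>(range (\<lambda>n. closure (F n)))) = {}"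
      by (intro Met_TC.metric_Baire_category_alt) (auto simp: complete_UNIV)
    then show False using UNIV by simp
  qed
  then obtain n x0 where "x0 \<in> interior (closure (F n))" by auto
  then obtain r where r: "r > 0" and ball: "cball x0 r \<subseteq> closure (F n)"
    by (auto simp: mem_interior_cball)
  \<comment> \<open>the set \<open>F n\<close> is convex and symmetric, so its closure contains a ball around \<open>0\<close>\<close>
  have small: "\<exists>u\<in>F n. norm (y - u) \<le> \<epsilon>" if "norm y \<le> r" "\<epsilon> > 0" for y \<epsilon>
  proof -
    have "x0 + y \<in> closure (F n)" "x0 - y \<in> closure (F n)"
      using that ball by (auto intro!: subsetD[OF ball] simp: dist_norm)
    then obtain u v where u: "u \<in> F n" "norm (u - (x0 + y)) < \<epsilon>"
      and v: "v \<in> F n" "norm (v - (x0 - y)) < \<epsilon>"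
      using \<open>\<epsilon> > 0\<close> unfolding closure_approachable dist_norm by metis
    have "norm (basis_proj e {..<N} ((1/2) *\<^sub>R (u - v))) \<le> real n" for N
    proof -
      have "norm (basis_proj e {..<N} u - basis_proj e {..<N} v)
        \<le> norm (basis_proj e {..<N} u) + norm (basis_proj e {..<N} v)"
        by (rule norm_triangle_ineq4)
      also have "\<dots> \<le> real n + real n" using u(1) v(1) by (intro add_mono) (auto simp: F_def)
      finally show ?thesis by (simp add: basis_proj_linear[OF e])
    qed
    then have "(1/2) *\<^sub>R (u - v) \<in> F n" by (simp add: F_def)
    moreover have "y - (1/2) *\<^sub>R (u - v) = (1/2) *\<^sub>R ((v - (x0 - y)) - (u - (x0 + y)))"
      by (simp add: algebra_simps flip: scaleR_2)
    then have "norm (y - (1/2) *\<^sub>R (u - v)) = norm ((v - (x0 - y)) - (u - (x0 + y))) / 2"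
      by simp
    moreover have "norm ((v - (x0 - y)) - (u - (x0 + y))) \<le> norm (v - (x0 - y)) + norm (u - (x0 + y))"
      by (rule norm_triangle_ineq4)
    ultimately show ?thesis using u v by (intro bexI[of _ "(1/2) *\<^sub>R (u - v)"]) linarith+
  qed
  show ?thesis
  proof
    show "(real n + 1) / r > 0" using r by simp
    fix y :: 'a and \<epsilon> :: real assume \<epsilon>: "\<epsilon> > 0"
    show "\<exists>u. norm (y - u) \<le> \<epsilon> \<and> (\<forall>N. norm (basis_proj e {..<N} u) \<le> (real n + 1) / r * norm y)"
    proof (cases "y = 0")
      case True
      then show ?thesis using \<epsilon> e
        by (intro exI[of _ 0]) (simp add: basis_proj_def coeffs_zero)
    next
      case False
      define s where "s = r / norm y"
      have s: "s > 0" using False r by (simp add: s_def)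
      have "norm (s *\<^sub>R y) \<le> r" using False r by (simp add: s_def)
      then obtain u where u: "u \<in> F n" "norm (s *\<^sub>R y - u) \<le> s * \<epsilon>"
        using small s \<epsilon> by (metis mult_pos_pos)
      have "y - (1/s) *\<^sub>R u = (1/s) *\<^sub>R (s *\<^sub>R y - u)"
        using s by (simp add: scaleR_diff_right)
      then have "norm (y - (1/s) *\<^sub>R u) = norm (s *\<^sub>R y - u) / s" using s by simp
      then have "norm (y - (1/s) *\<^sub>R u) \<le> \<epsilon>"
        using u(2) s by (simp add: pos_divide_le_eq mult.commute)
      moreover have "norm (basis_proj e {..<N} ((1/s) *\<^sub>R u)) \<le> (real n + 1) / r * norm y" for N
      proof -
        have "norm (basis_proj e {..<N} u) \<le> real n + 1"
          using u(1) by (auto simp: F_def intro: order_trans)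
        then have "(1/s) * norm (basis_proj e {..<N} u) \<le> (1/s) * (real n + 1)"
          using s by (intro mult_left_mono) auto
        then show ?thesis
          using s by (simp add: basis_proj_linear[OF e]) (simp add: s_def field_simps)
      qed
      ultimately show ?thesis by blast
    qed
  qed
qed

text \<open>
  Iterated approximation writes every vector as a series of vectors \<open>u i\<close> whose partial sums
  decay geometrically in \<open>i\<close>.  The termwise sums of the coefficients of the \<open>u i\<close> again give an
  expansion of the vector, so by uniqueness its partial sums inherit the bound.  This is
  Banach's theorem that the coefficient functionals of a Schauder basis are continuous.
\<close>
theorem schauder_partial_sums_bounded:
  assumes e: "schauder_basis (e :: nat \<Rightarrow> 'a::complex_banach)"
  obtains M where "M > 0" "\<And>N x. norm (basis_proj e {..<N} x) \<le> M * norm x"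
proof -
  obtain C where C: "C > 0" and approx:
    "\<And>y \<epsilon>. \<epsilon> > 0 \<Longrightarrow> \<exists>u. norm (y - u) \<le> \<epsilon> \<and> (\<forall>N. norm (basis_proj e {..<N} u) \<le> C * norm y)"
    using approximants_with_bounded_partial_sums[OF e] by metis
  define g where "g y \<epsilon> = (SOME u. norm (y - u) \<le> \<epsilon> \<and> (\<forall>N. norm (basis_proj e {..<N} u) \<le> C * norm y))"
    for y \<epsilon>
  have g: "norm (y - g y \<epsilon>) \<le> \<epsilon>" "norm (basis_proj e {..<N} (g y \<epsilon>)) \<le> C * norm y"
    if "\<epsilon> > 0" for y \<epsilon> N
    using someI_ex[OF approx[OF that, of y]] by (auto simp: g_def)
  have "norm (basis_proj e {..<N} x) \<le> (2 * C) * norm x" for N x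
  proof (cases "x = 0")
    case True
    then show ?thesis using e by (simp add: basis_proj_def coeffs_zero)
  next
    case False
    define h where "h = (\<lambda>i::nat. norm x * (1/2)^i)"
    \<comment> \<open>\<open>y i\<close> is what remains of \<open>x\<close> after \<open>i\<close> approximants; its norm is at most \<open>h i\<close>\<close>
    define y where "y = rec_nat x (\<lambda>i y. y - g y (h (Suc i)))"
    define u where "u i = g (y i) (h (Suc i))" for i
    have y0: "y 0 = x" and ySuc: "y (Suc i) = y i - u i" for i
      by (simp_all add: y_def u_def)
    have hpos: "h i > 0" for i using False by (simp add: h_def)
    have hsums: "h sums (2 * norm x)"
      using sums_mult[OF geometric_sums[of "1/2::real"], of "norm x"]
      by (simp add: h_def mult.commute)
    have yle: "norm (y i) \<le> h i" for i
    proof (cases i)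
      case 0
      then show ?thesis by (simp add: y0 h_def)
    next
      case (Suc j)
      then show ?thesis using g(1)[OF hpos, of "y j" "Suc j"] by (simp add: ySuc u_def)
    qed
    have Pu: "norm (basis_proj e {..<N} (u i)) \<le> C * h i" for N i
    proof -
      have "norm (basis_proj e {..<N} (u i)) \<le> C * norm (y i)"
        unfolding u_def by (rule g(2)[OF hpos])
      also have "\<dots> \<le> C * h i" using yle C by (intro mult_left_mono) auto
      finally show ?thesis .
    qed
    have usums: "u sums x"
    proof -
      have "(\<Sum>i<I. u i) = x - y I" for I
        by (induction I) (simp_all add: y0 ySuc)
      moreover have "y \<longlonglongrightarrow> 0"
        using yle by (intro Lim_null_comparison[OF _ summable_LIMSEQ_zero[OF sums_summable[OF hsums]]])
          (auto intro: always_eventually)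
      ultimately show ?thesis unfolding sums_def using tendsto_diff[OF tendsto_const[of x]] by fastforce
    qed
    have Ch: "(\<lambda>i. C * h i) sums (2 * C * norm x)"
      using sums_mult[OF hsums, of C] by (simp add: mult_ac)
    have ck: "summable (\<lambda>i. norm (coeffs e (u i) k))" for k
    proof -
      have "norm (norm (coeffs e (u i) k)) \<le> 2 * (C * h i) / norm (e k)" for i
      proof -
        have "coeffs e (u i) k *\<^sub>C e k = basis_proj e {..<Suc k} (u i) - basis_proj e {..<k} (u i)"
          by (simp add: basis_proj_def)
        then have "cmod (coeffs e (u i) k) * norm (e k)
            = norm (basis_proj e {..<Suc k} (u i) - basis_proj e {..<k} (u i))"
          by (metis norm_scaleC)
        also have "\<dots> \<le> C * h i + C * h i"
          by (rule norm_triangle_le_diff) (intro add_mono Pu)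
        finally show ?thesis using schauder_basis_nonzero[OF e, of k] by (simp add: field_simps)
      qed
      moreover have "summable (\<lambda>i. 2 * (C * h i) / norm (e k))"
        by (intro summable_divide summable_mult sums_summable[OF hsums])
      ultimately show ?thesis by (rule summable_comparison_test'[rotated])
    qed
    define a where "a k = (\<Sum>i. coeffs e (u i) k)" for k
    have asums: "(\<lambda>i. coeffs e (u i) k) sums a k" for k
      unfolding a_def by (intro summable_sums summable_norm_cancel[OF ck])
    have Qsums: "(\<lambda>i. basis_proj e {..<N} (u i)) sums (\<Sum>k<N. a k *\<^sub>C e k)" for N
      unfolding basis_proj_def
      by (intro sums_sum bounded_linear.sums[OF bounded_linear_scaleC_left] asums)
    have sumPu: "summable (\<lambda>i. norm (basis_proj e {..<N} (u i)))" for N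
      using Pu by (intro summable_comparison_test'[OF sums_summable[OF Ch]]) auto
    have "(\<lambda>N. \<Sum>k<N. a k *\<^sub>C e k) \<longlonglongrightarrow> x"
    proof -
      define d where "d i N = norm (basis_proj e {..<N} (u i) - u i)" for i N
      have lim: "(\<lambda>N. basis_proj e {..<N} (u i)) \<longlonglongrightarrow> u i" for i
        using coeffs_sums[OF e, of "u i"] by (simp add: sums_def basis_proj_def)
      have dlim: "d i \<longlonglongrightarrow> 0" for i
        unfolding d_def using lim by (intro tendsto_norm_zero) (simp add: LIM_zero)
      have ule: "norm (u i) \<le> C * h i" for i
        by (rule LIMSEQ_le_const2[OF tendsto_norm[OF lim]]) (use Pu in auto)
      have dle: "norm (d i N) \<le> 2 * (C * h i)" for i N
      proof -
        have "norm (basis_proj e {..<N} (u i) - u i) \<le> C * h i + C * h i"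
          by (rule norm_triangle_le_diff) (intro add_mono Pu ule)
        then show ?thesis by (simp add: d_def)
      qed
      have sum2: "summable (\<lambda>i. 2 * (C * h i))" by (intro summable_mult sums_summable[OF hsums])
      have "(\<lambda>N. \<Sum>i. d i N) \<longlonglongrightarrow> (\<Sum>i. 0)"
        using tannerys_theorem[of d "\<lambda>_. 0" sequentially "\<lambda>i. 2 * (C * h i)"] dlim dle sum2
        by (auto intro: always_eventually)
      then have lim0: "(\<lambda>N. \<Sum>i. d i N) \<longlonglongrightarrow> 0" by simp
      have "norm ((\<Sum>k<N. a k *\<^sub>C e k) - x) \<le> (\<Sum>i. d i N)" for N
      proof -
        have "(\<lambda>i. basis_proj e {..<N} (u i) - u i) sums ((\<Sum>k<N. a k *\<^sub>C e k) - x)"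
          by (intro sums_diff Qsums usums)
        moreover have "summable (\<lambda>i. d i N)"
          using dle by (intro summable_comparison_test'[OF sum2]) auto
        ultimately show ?thesis
          unfolding d_def using summable_norm sums_unique by metis
      qed
      then have "(\<lambda>N. (\<Sum>k<N. a k *\<^sub>C e k) - x) \<longlonglongrightarrow> 0"
        by (intro Lim_null_comparison[OF _ lim0]) (auto intro: always_eventually)
      then show ?thesis by (simp add: LIM_zero_iff)
    qed
    then have "coeffs e x = a" by (intro coeffs_eqI[OF e]) (simp add: sums_def)
    then have "(\<lambda>i. basis_proj e {..<N} (u i)) sums basis_proj e {..<N} x"
      using Qsums[of N] by (simp add: basis_proj_def)
    then have "norm (basis_proj e {..<N} x) \<le> (\<Sum>i. norm (basis_proj e {..<N} (u i)))"
      using summable_norm[OF sumPu[of N]] sums_unique by metis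
    also have "\<dots> \<le> (\<Sum>i. C * h i)"
      by (intro suminf_le Pu sumPu sums_summable[OF Ch])
    also have "\<dots> = 2 * C * norm x" using sums_unique[OF Ch] by simp
    finally show ?thesis by simp
  qed
  then show ?thesis using C by (intro that[of "2 * C"]) auto
qed

lemma norm_coeffs_term_bounded:
  assumes e: "schauder_basis (e :: nat \<Rightarrow> 'a::complex_banach)"
  obtains M where "M > 0" "\<And>j x. norm (coeffs e x j *\<^sub>C e j) \<le> M * norm x"
proof -
  obtain M where M: "M > 0" "\<And>N x. norm (basis_proj e {..<N} x) \<le> M * norm x"
    using schauder_partial_sums_bounded[OF e] by blast
  have "norm (coeffs e x j *\<^sub>C e j) \<le> (M + M) * norm x" for x j
  proof -
    have "coeffs e x j *\<^sub>C e j = basis_proj e {..<Suc j} x - basis_proj e {..<j} x"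
      by (simp add: basis_proj_def)
    then show ?thesis
      using norm_triangle_le_diff[OF add_mono[OF M(2)[of "Suc j" x] M(2)[of j x]]]
      by (simp add: distrib_right)
  qed
  then show ?thesis using M by (intro that[of "M + M"]) auto
qed

lemma bounded_linear_basis_proj:
  assumes e: "schauder_basis (e :: nat \<Rightarrow> 'a::complex_banach)"
  shows "bounded_linear (basis_proj e A)"
proof -
  obtain M where M: "M > 0" "\<And>j x. norm (coeffs e x j *\<^sub>C e j) \<le> M * norm x"
    using norm_coeffs_term_bounded[OF e] by blast
  show ?thesis
  proof (rule bounded_linear_intro)
    show "norm (basis_proj e A x) \<le> norm x * (real (card A) * M)" for x
      using sum_norm_le[of A "\<lambda>j. coeffs e x j *\<^sub>C e j" "\<lambda>_. M * norm x"] M(2)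
      by (simp add: basis_proj_def mult_ac)
  qed (simp_all add: basis_proj_linear[OF e])
qed


section \<open>Dyadic blocks and the Fourier matrix\<close>

definition first :: "nat \<Rightarrow> nat" where
  "first k = 2 ^ k - 1"

definition block :: "nat \<Rightarrow> nat set" where
  "block k = {first k ..< first (Suc k)}"

text \<open>
  The integer part of the binary logarithm of \<open>m + 1\<close>.
\<close>
definition level :: "nat \<Rightarrow> nat" where
  "level m = (LEAST k. Suc m < 2 ^ Suc k)"

lemma Suc_first: "Suc (first k) = 2 ^ k"
  by (simp add: first_def)

lemma level_bounds: "2 ^ level m \<le> Suc m" "Suc m < 2 ^ Suc (level m)"
proof -
  have ex: "Suc m < 2 ^ Suc m" by (rule less_exp)
  show "Suc m < 2 ^ Suc (level m)"
    unfolding level_def by (rule LeastI[of _ m]) (rule ex)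
  show "2 ^ level m \<le> Suc m"
  proof (cases "level m")
    case (Suc k)
    then have "\<not> Suc m < 2 ^ Suc k" unfolding level_def by (metis lessI not_less_Least)
    then show ?thesis using Suc by simp
  qed simp
qed

lemma level_less_iff: "level m < K \<longleftrightarrow> m < first K"
proof
  assume "level m < K"
  then have "(2::nat) ^ Suc (level m) \<le> 2 ^ K" by (intro power_increasing) auto
  then show "m < first K" using level_bounds(2)[of m] Suc_first[of K] by linarith
next
  assume "m < first K"
  then have "(2::nat) ^ level m < 2 ^ K" using level_bounds(1)[of m] Suc_first[of K] by linarith
  then show "level m < K" by simp
qed

lemma mem_block_iff [simp]: "m \<in> block k \<longleftrightarrow> level m = k"
proof -
  have "m \<in> block k \<longleftrightarrow> \<not> level m < k \<and> level m < Suc k"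
    unfolding level_less_iff block_def by auto
  then show ?thesis by auto
qed

lemma finite_block [simp]: "finite (block k)"
  by (simp add: block_def)

lemma card_block [simp]: "card (block k) = 2 ^ k"
  by (simp add: block_def first_def)

lemma level_first [simp]: "level (first k) = k"
proof -
  have "Suc (first k) < Suc (first (Suc k))" unfolding Suc_first by simp
  then have "first k \<in> block k" by (simp add: block_def del: mem_block_iff)
  then show ?thesis by simp
qed

lemma le_first: "n \<le> first n"
  using less_exp[of n] Suc_first[of n] by linarith

lemma sum_up_to_level: "(\<Sum>m<first K. f m) = (\<Sum>k<K. \<Sum>m\<in>block k. f m)"
proof (induction K)
  case (Suc K)
  have "{..<first (Suc K)} = {..<first K} \<union> block K"
    by (auto simp flip: level_less_iff)
  moreover have "{..<first K} \<inter> block K = {}"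
    by (auto simp flip: level_less_iff)
  ultimately show ?case using Suc by (simp add: sum.union_disjoint)
qed (simp add: first_def)

text \<open>
  The block diagonal matrix with the unitary discrete Fourier transform of \<open>\<int> / 2 ^ k\<close> as block
  of level \<open>k\<close>.  In a block \<open>Suc m\<close> runs through all residues modulo \<open>2 ^ k\<close>, and the position
  \<open>first k\<close>, where \<open>Suc p = 2 ^ k\<close>, carries the residue \<open>0\<close>, so that the column at
  \<open>first k\<close> is constant.
\<close>
definition fourier :: "nat \<Rightarrow> nat \<Rightarrow> complex" where
  "fourier m p = (if level m = level p
     then cis (2 * pi * (real (Suc m) * real (Suc p)) / 2 ^ level m) / of_real (sqrt (2 ^ level m))
     else 0)"

lemma fourier_sym: "fourier m p = fourier p m"
  by (simp add: fourier_def mult.commute)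

lemma cis_2pi_int: "cis (2 * pi * of_int d) = 1"
  using sin_int_2pin[of d] cos_int_2pin[of d] by (simp add: complex_eq_iff mult.assoc)

lemma fourier_first:
  assumes "level m = k"
  shows "fourier m (first k) = 1 / of_real (sqrt (2 ^ k))"
proof -
  have "real (Suc (first k)) = 2 ^ k" by (simp add: Suc_first)
  then have "2 * pi * (real (Suc m) * real (Suc (first k))) / 2 ^ k = 2 * pi * of_int (int (Suc m))"
    by simp
  then have "cis (2 * pi * (real (Suc m) * real (Suc (first k))) / 2 ^ k) = 1"
    using cis_2pi_int[of "int (Suc m)"] by metis
  then show ?thesis using assms by (simp add: fourier_def)
qed

text \<open>
  Distinct rows differ by a nontrivial root of unity, whose powers over one block sum to zero.
\<close>
lemma fourier_orthonormal:
  assumes "level m = k" "level m' = k"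
  shows "(\<Sum>p\<in>block k. fourier m p * cnj (fourier m' p)) = (if m = m' then 1 else 0)"
proof -
  define N where "N = (2::nat) ^ k"
  define d where "d = int m - int m'"
  define q where "q = cis (2 * pi * of_int d / real N)"
  have N: "N > 0" by (simp add: N_def)
  have entry: "fourier m p * cnj (fourier m' p) = q ^ Suc p / of_nat N" if "p \<in> block k" for p
  proof -
    have sq: "complex_of_real (sqrt (2 ^ k)) * complex_of_real (sqrt (2 ^ k)) = of_nat N"
      by (simp add: N_def flip: of_real_mult)
    have "fourier m p * cnj (fourier m' p)
      = cis (2 * pi * (real (Suc m) * real (Suc p)) / real N - 2 * pi * (real (Suc m') * real (Suc p)) / real N)
        / of_nat N"
      using that assms sq by (simp add: fourier_def cis_cnj N_def cis_mult)
    also have "2 * pi * (real (Suc m) * real (Suc p)) / real N - 2 * pi * (real (Suc m') * real (Suc p)) / real N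
      = real (Suc p) * (2 * pi * of_int d / real N)"
      using N by (simp add: d_def field_simps)
    also have "cis \<dots> = q ^ Suc p" unfolding q_def by (rule Complex.DeMoivre[symmetric])
    finally show ?thesis .
  qed
  have "(\<Sum>p\<in>block k. fourier m p * cnj (fourier m' p)) = (\<Sum>p\<in>block k. q ^ Suc p) / of_nat N"
    by (simp add: entry sum_divide_distrib)
  also have "\<dots> = (if m = m' then 1 else 0)"
  proof (cases "m = m'")
    case True
    then have "q = 1" by (simp add: q_def d_def)
    then show ?thesis using True N by (simp add: N_def)
  next
    case False
    have "q ^ N = cis (2 * pi * of_int d)"
      unfolding q_def Complex.DeMoivre using N by simp
    then have qN: "q ^ N = 1" by (simp add: cis_2pi_int)
    have "q \<noteq> 1"
    proof
      assume "q = 1"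
      then have "cos (2 * pi * of_int d / real N) = 1" by (simp add: q_def complex_eq_iff)
      then obtain i :: int where "2 * pi * of_int d / real N = of_int i * 2 * pi"
        using cos_one_2pi_int by auto
      then have "of_int d = real_of_int (i * int N)" using N by (simp add: field_simps)
      then have "d = i * int N" by (simp only: of_int_eq_iff)
      moreover have "\<bar>d\<bar> < int N"
      proof -
        have "N \<le> Suc m" "Suc m < 2 * N" "N \<le> Suc m'" "Suc m' < 2 * N"
          using level_bounds[of m] level_bounds[of m'] assms by (simp_all add: N_def)
        then show ?thesis unfolding d_def by linarith
      qed
      ultimately have "d = 0"
        by (metis abs_mult_self_eq dvd_triv_right zdvd_not_zless abs_ge_zero zero_less_abs_iff dvd_abs_iff)
      then show False using False by (simp add: d_def)
    qed
    have "(\<Sum>p\<in>block k. q ^ Suc p) = (\<Sum>j<N. q ^ Suc (j + (N - 1)))"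
    proof (rule sum.reindex_bij_witness[of _ "\<lambda>j. j + (N - 1)" "\<lambda>p. p - (N - 1)"])
    qed (use N in \<open>auto simp: block_def first_def N_def simp del: mem_block_iff\<close>)
    also have "\<dots> = (\<Sum>j<N. q ^ j)"
      using N qN by (intro sum.cong) (auto simp: power_add simp flip: power_Suc)
    also have "\<dots> = 0"
      using \<open>q \<noteq> 1\<close> by (simp add: geometric_sum qN)
    finally show ?thesis using False by simp
  qed
  finally show ?thesis .
qed

definition fourier_transform :: "(nat \<Rightarrow> complex) \<Rightarrow> nat \<Rightarrow> complex" where
  "fourier_transform c p = (\<Sum>m\<in>block (level p). c m * fourier m p)"

lemma fourier_transform_inverse:
  "(\<Sum>p\<in>block (level m). fourier_transform c p * cnj (fourier m p)) = c m"
proof -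
  have "(\<Sum>p\<in>block (level m). fourier_transform c p * cnj (fourier m p))
    = (\<Sum>p\<in>block (level m). \<Sum>n\<in>block (level m). c n * (fourier n p * cnj (fourier m p)))"
    by (intro sum.cong) (auto simp: fourier_transform_def sum_distrib_right mult.assoc)
  also have "\<dots> = (\<Sum>n\<in>block (level m). c n * (\<Sum>p\<in>block (level m). fourier n p * cnj (fourier m p)))"
    by (subst sum.swap) (simp add: sum_distrib_left)
  also have "\<dots> = (\<Sum>n\<in>block (level m). if n = m then c n else 0)"
    by (intro sum.cong) (auto simp: fourier_orthonormal)
  also have "\<dots> = c m" by (simp add: sum.delta)
  finally show ?thesis .
qed

lemma fourier_transform_of_inverse:
  "fourier_transform (\<lambda>m. \<Sum>p\<in>block (level m). w p * cnj (fourier m p)) p = w p"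
proof -
  have "fourier_transform (\<lambda>m. \<Sum>p\<in>block (level m). w p * cnj (fourier m p)) p
    = (\<Sum>m\<in>block (level p). \<Sum>n\<in>block (level p). w n * (fourier m p * cnj (fourier m n)))"
    unfolding fourier_transform_def
    by (intro sum.cong) (auto simp: sum_distrib_left mult_ac)
  also have "\<dots> = (\<Sum>n\<in>block (level p). w n * (\<Sum>m\<in>block (level p). fourier p m * cnj (fourier n m)))"
    by (subst sum.swap) (simp add: sum_distrib_left fourier_sym)
  also have "\<dots> = (\<Sum>n\<in>block (level p). if n = p then w n else 0)"
    by (intro sum.cong) (auto simp: fourier_orthonormal)
  also have "\<dots> = w p" by (simp add: sum.delta)
  finally show ?thesis .
qed

lemma fourier_parseval:
  "(\<Sum>p\<in>block k. (cmod (fourier_transform c p))\<^sup>2) = (\<Sum>m\<in>block k. (cmod (c m))\<^sup>2)"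
proof -
  let ?c = "fourier_transform c"
  have "complex_of_real (\<Sum>p\<in>block k. (cmod (?c p))\<^sup>2) = (\<Sum>p\<in>block k. ?c p * cnj (?c p))"
    by (simp only: of_real_sum complex_norm_square)
  also have "\<dots> = (\<Sum>p\<in>block k. \<Sum>m\<in>block k. ?c p * cnj (fourier m p) * cnj (c m))"
    by (intro sum.cong) (auto simp: fourier_transform_def[of c] sum_distrib_left mult_ac)
  also have "\<dots> = (\<Sum>m\<in>block k. (\<Sum>p\<in>block k. ?c p * cnj (fourier m p)) * cnj (c m))"
    by (subst sum.swap) (simp add: sum_distrib_right)
  also have "\<dots> = (\<Sum>m\<in>block k. c m * cnj (c m))"
    by (intro sum.cong refl) (metis fourier_transform_inverse mem_block_iff)
  also have "\<dots> = complex_of_real (\<Sum>m\<in>block k. (cmod (c m))\<^sup>2)"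
    by (simp only: of_real_sum complex_norm_square)
  finally show ?thesis by (simp only: of_real_eq_iff)
qed


section \<open>The basis and the norms of its finite combinations\<close>

text \<open>
  In each block the first position is reserved for the coordinate along \<open>X k\<close>.  The remaining
  positions, in increasing order, carry the coordinates of \<open>\<ell>\<^sup>2\<close>.
\<close>
definition inner_positions :: "nat set" where
  "inner_positions = {p. p \<noteq> first (level p)}"

definition spread :: "ell2 \<Rightarrow> nat \<Rightarrow> complex" where
  "spread y p = (if p \<in> inner_positions
     then ell2_nth y (inv (enumerate inner_positions) p) else 0)"

lemma spread_off: "p \<notin> inner_positions \<Longrightarrow> spread y p = 0"
  by (simp add: spread_def)

lemma norm_spread_le: "cmod (spread y p) \<le> norm y"
  by (simp add: spread_def norm_ell2_nth_le)

lemma infinite_inner_positions: "infinite inner_positions"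
proof
  assume fin: "finite inner_positions"
  have "range (\<lambda>k. (2::nat) ^ Suc k) \<subseteq> inner_positions"
  proof clarify
    fix k
    have less: "(1::nat) < 2 ^ Suc k" by (rule one_less_power) auto
    then have "(2::nat) ^ Suc k \<in> block (Suc k)"
      unfolding block_def first_def by auto
    moreover have "(2::nat) ^ Suc k \<noteq> first (Suc k)" using less by (simp add: first_def)
    ultimately show "2 ^ Suc k \<in> inner_positions" by (simp add: inner_positions_def)
  qed
  moreover have "infinite (range (\<lambda>k. (2::nat) ^ Suc k))"
    by (rule range_inj_infinite) (auto simp: inj_on_def)
  ultimately show False using fin finite_subset by blast
qed

lemma spread_enumerate [simp]: "spread y (enumerate inner_positions n) = ell2_nth y n"
  using enumerate_in_set[OF infinite_inner_positions]
    strict_mono_enumerate[OF infinite_inner_positions]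
  by (simp add: spread_def strict_mono_imp_inj_on)

lemma spread_first [simp]: "spread y (first k) = 0"
  by (simp add: spread_def inner_positions_def)

lemma spread_sums: "(\<lambda>p. (cmod (spread y p))\<^sup>2) sums (norm y)\<^sup>2"
proof -
  have "(\<lambda>n. (cmod (spread y (enumerate inner_positions n)))\<^sup>2) sums (norm y)\<^sup>2"
    using sq_summable_ell2_nth[of y] summable_sums
    by (simp add: sq_summable_def norm_ell2_power2)
  then show ?thesis
  proof (subst (asm) sums_mono_reindex[OF strict_mono_enumerate[OF infinite_inner_positions]])
    show "(cmod (spread y n))\<^sup>2 = 0" if "n \<notin> range (enumerate inner_positions)" for n
      using that range_enumerate[OF infinite_inner_positions] by (simp add: spread_def)
  qed
qed

lemma spread_surj:
  assumes "summable (\<lambda>p. (cmod (w p))\<^sup>2)" "\<And>p. p \<notin> inner_positions \<Longrightarrow> w p = 0"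
  obtains y where "spread y = w"
proof
  have "summable (\<lambda>n. (cmod (w (enumerate inner_positions n)))\<^sup>2)"
    using assms range_enumerate[OF infinite_inner_positions]
    by (subst summable_mono_reindex[OF strict_mono_enumerate[OF infinite_inner_positions]]) auto
  then have nth: "ell2_nth (Abs_ell2 (\<lambda>n. w (enumerate inner_positions n))) = (\<lambda>n. w (enumerate inner_positions n))"
    by (simp add: Abs_ell2_inverse sq_summable_def)
  show "spread (Abs_ell2 (\<lambda>n. w (enumerate inner_positions n))) = w"
  proof
    fix p
    show "spread (Abs_ell2 (\<lambda>n. w (enumerate inner_positions n))) p = w p"
    proof (cases "p \<in> inner_positions")
      case True
      then obtain n where "p = enumerate inner_positions n"
        using range_enumerate[OF infinite_inner_positions] by blast
      then show ?thesis by (simp add: nth)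
    qed (simp add: assms spread_def)
  qed
qed

lemma spread_zero: "spread 0 p = 0"
  by (simp add: spread_def zero_ell2.rep_eq)

lemma spread_add: "spread (x + y) p = spread x p + spread y p"
  by (simp add: spread_def plus_ell2.rep_eq)

lemma spread_diff: "spread (x - y) p = spread x p - spread y p"
  by (simp add: spread_def minus_ell2.rep_eq)

lemma spread_scaleC: "spread (a *\<^sub>C x) p = a * spread x p"
  by (simp add: spread_def scaleC_ell2.rep_eq)

lemma spread_sum: "spread (\<Sum>i\<in>I. y i) p = (\<Sum>i\<in>I. spread (y i) p)"
  by (induction I rule: infinite_finite_induct) (simp_all add: spread_zero spread_add)

definition fourier_row :: "nat \<Rightarrow> ell2" where
  "fourier_row m = (SOME y. spread y = (\<lambda>p. if p \<in> inner_positions then fourier m p else 0))"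

lemma spread_fourier_row:
  "spread (fourier_row m) p = (if p \<in> inner_positions then fourier m p else 0)"
proof -
  let ?w = "\<lambda>p. if p \<in> inner_positions then fourier m p else 0"
  have "summable (\<lambda>p. (cmod (?w p))\<^sup>2)"
    by (rule summable_finite[of "block (level m)"]) (auto simp: fourier_def)
  then obtain y where "spread y = ?w" by (rule spread_surj) auto
  then have "spread (fourier_row m) = ?w" unfolding fourier_row_def by (rule someI)
  then show ?thesis by simp
qed

text \<open>
  The images of the basis of the direct sum, that is of the vectors \<open>X k\<close> (at the positions
  \<open>first k\<close>) and of the unit vectors of \<open>\<ell>\<^sup>2\<close> (at the inner positions), under the Fourier matrix.
  Since the first column of each block is constant, every vector of a block has the same component
  along \<open>X k\<close>.
\<close>
definition psi :: "(nat \<Rightarrow> 'a::complex_banach) \<Rightarrow> nat \<Rightarrow> 'a \<times> ell2" where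
  "psi X m = (complex_of_real (1 / sqrt (2 ^ level m)) *\<^sub>C X (level m), fourier_row m)"

definition block_mean :: "(nat \<Rightarrow> complex) \<Rightarrow> nat \<Rightarrow> complex" where
  "block_mean c k = (\<Sum>m\<in>block k. c m) / of_real (sqrt (2 ^ k))"

lemma block_mean_eq: "block_mean c k = fourier_transform c (first k)"
  by (simp add: block_mean_def fourier_transform_def fourier_first sum_divide_distrib)

lemma norm_prod_power2: "(norm z)\<^sup>2 = (norm (fst z))\<^sup>2 + (norm (snd z))\<^sup>2"
  by (simp add: norm_prod_def)

lemma fst_sum_psi:
  "fst (\<Sum>m<first K. c m *\<^sub>C psi X m) = (\<Sum>k<K. block_mean c k *\<^sub>C X k)"
proof -
  have "fst (\<Sum>m<first K. c m *\<^sub>C psi X m) = (\<Sum>k<K. \<Sum>m\<in>block k. fst (c m *\<^sub>C psi X m))"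
    by (simp add: fst_sum sum_up_to_level)
  also have "\<dots> = (\<Sum>k<K. block_mean c k *\<^sub>C X k)"
  proof (intro sum.cong refl)
    fix k
    have "block_mean c k = (\<Sum>m\<in>block k. c m * of_real (1 / sqrt (2 ^ k)))"
      by (simp add: block_mean_def sum_divide_distrib)
    then show "(\<Sum>m\<in>block k. fst (c m *\<^sub>C psi X m)) = block_mean c k *\<^sub>C X k"
      by (simp add: scaleC_sum_left scaleC_scaleC psi_def scaleC_prod_def)
  qed
  finally show ?thesis .
qed

lemma spread_snd_sum_psi:
  "spread (snd (\<Sum>m<first K. c m *\<^sub>C psi X m)) p
     = (if p \<in> inner_positions \<and> level p < K then fourier_transform c p else 0)"
proof -
  have "spread (snd (\<Sum>m<first K. c m *\<^sub>C psi X m)) p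
    = (\<Sum>m<first K. c m * (if p \<in> inner_positions then fourier m p else 0))"
    by (simp add: snd_sum spread_sum psi_def scaleC_prod_def spread_scaleC spread_fourier_row)
  also have "\<dots> = (if p \<in> inner_positions \<and> level p < K then fourier_transform c p else 0)"
  proof (cases "p \<in> inner_positions \<and> level p < K")
    case True
    have "(\<Sum>m<first K. c m * fourier m p) = (\<Sum>m\<in>block (level p). c m * fourier m p)"
      using True by (intro sum.mono_neutral_right)
        (auto simp: fourier_def simp flip: level_less_iff)
    then show ?thesis using True by (simp add: fourier_transform_def)
  next
    case False
    then show ?thesis
      by (auto intro!: sum.neutral simp: fourier_def simp flip: level_less_iff)
  qed
  finally show ?thesis .
qed

text \<open>
  Parseval's identity in each block, with the frequency at \<open>first k\<close> removed because it went into
  the component in the first summand.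
\<close>
lemma norm_snd_sum_psi:
  "(norm (snd (\<Sum>m<first K. c m *\<^sub>C psi X m)))\<^sup>2
     = (\<Sum>m<first K. (cmod (c m))\<^sup>2) - (\<Sum>k<K. (cmod (block_mean c k))\<^sup>2)"
proof -
  define y where "y = snd (\<Sum>m<first K. c m *\<^sub>C psi X m)"
  have spread_y: "spread y p = (if p \<in> inner_positions \<and> level p < K then fourier_transform c p else 0)"
    for p unfolding y_def by (rule spread_snd_sum_psi)
  have "(\<lambda>p. (cmod (spread y p))\<^sup>2) sums (\<Sum>p<first K. (cmod (spread y p))\<^sup>2)"
    by (rule sums_finite) (auto simp: spread_y simp flip: level_less_iff)
  then have "(norm y)\<^sup>2 = (\<Sum>p<first K. (cmod (spread y p))\<^sup>2)"
    using spread_sums sums_unique2 by blast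
  also have "\<dots> = (\<Sum>k<K. (\<Sum>m\<in>block k. (cmod (c m))\<^sup>2) - (cmod (block_mean c k))\<^sup>2)"
    unfolding sum_up_to_level[of "\<lambda>p. (cmod (spread y p))\<^sup>2"]
  proof (intro sum.cong refl)
    fix k assume k: "k \<in> {..<K}"
    have "(\<Sum>m\<in>block k. (cmod (c m))\<^sup>2)
      = (cmod (fourier_transform c (first k)))\<^sup>2
        + (\<Sum>p\<in>block k - {first k}. (cmod (fourier_transform c p))\<^sup>2)"
      unfolding fourier_parseval[where c = c, symmetric] by (rule sum.remove) auto
    moreover have "(\<Sum>p\<in>block k. (cmod (spread y p))\<^sup>2)
      = (\<Sum>p\<in>block k - {first k}. (cmod (fourier_transform c p))\<^sup>2)"
      using k by (subst sum.remove[of _ "first k"])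
        (auto simp: spread_y inner_positions_def intro!: sum.cong)
    ultimately show "(\<Sum>p\<in>block k. (cmod (spread y p))\<^sup>2)
      = (\<Sum>m\<in>block k. (cmod (c m))\<^sup>2) - (cmod (block_mean c k))\<^sup>2"
      by (simp add: block_mean_eq)
  qed
  finally show ?thesis unfolding y_def[symmetric] by (simp add: sum_subtractf sum_up_to_level)
qed

lemma sum_psi_restrict:
  assumes "F \<subseteq> {..<first K}"
  shows "(\<Sum>m\<in>F. c m *\<^sub>C psi X m) = (\<Sum>m<first K. (if m \<in> F then c m else 0) *\<^sub>C psi X m)"
  using assms by (intro sum.mono_neutral_cong_left) auto

lemma finite_below_first:
  assumes "finite F"
  obtains K where "F \<subseteq> {..<first K}"
proof -
  obtain K where K: "\<And>m. m \<in> F \<Longrightarrow> level m < K"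
    using finite_nat_set_iff_bounded[of "level ` F"] assms by auto
  show ?thesis by (rule that[of K]) (use K in \<open>auto simp: level_less_iff\<close>)
qed

text \<open>
  The basic upper estimate.  As nothing is known about \<open>X\<close>, its component can only be bounded by
  the triangle inequality; the weights, which decay geometrically with the level, make this
  affordable.
\<close>
lemma norm_sum_psi_le:
  assumes X: "\<And>k. norm (X k) = 1" and F: "finite F"
  shows "norm (\<Sum>m\<in>F. c m *\<^sub>C psi X m)
    \<le> (\<Sum>m\<in>F. cmod (c m) / sqrt (2 ^ level m)) + sqrt (\<Sum>m\<in>F. (cmod (c m))\<^sup>2)"
proof -
  let ?z = "\<Sum>m\<in>F. c m *\<^sub>C psi X m"
  obtain K where K: "F \<subseteq> {..<first K}" using finite_below_first[OF F] by blast
  have "norm (fst ?z) \<le> (\<Sum>m\<in>F. cmod (c m) / sqrt (2 ^ level m))"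
    unfolding fst_sum using X
    by (intro sum_norm_le) (simp add: psi_def scaleC_prod_def norm_scaleC norm_divide)
  moreover have "norm (snd ?z) \<le> sqrt (\<Sum>m\<in>F. (cmod (c m))\<^sup>2)"
  proof (rule real_le_rsqrt)
    have "(\<Sum>m<first K. (cmod (if m \<in> F then c m else 0))\<^sup>2) = (\<Sum>m\<in>F. (cmod (c m))\<^sup>2)"
      using K by (intro sum.mono_neutral_cong_right) auto
    then show "(norm (snd ?z))\<^sup>2 \<le> (\<Sum>m\<in>F. (cmod (c m))\<^sup>2)"
      unfolding sum_psi_restrict[OF K] norm_snd_sum_psi by (simp add: sum_nonneg)
  qed
  moreover have "norm ?z \<le> norm (fst ?z) + norm (snd ?z)"
    using norm_Pair_le[of "fst ?z" "snd ?z"] by simp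
  ultimately show ?thesis by linarith
qed


section \<open>Expansions\<close>

lemma LIMSEQ_first: "filterlim first at_top sequentially"
  by (rule filterlim_at_top_mono[OF filterlim_ident]) (simp add: le_first)

lemma LIMSEQ_level: "filterlim level at_top sequentially"
  unfolding filterlim_at_top
proof
  fix K
  show "\<forall>\<^sub>F n in sequentially. K \<le> level n"
    by (rule eventually_sequentiallyI[of "first K"])
      (metis level_less_iff linorder_not_less)
qed

text \<open>
  The coordinates of a vector of the direct sum at all positions: coefficients with respect to
  \<open>X\<close> at the first position of each block, and coordinates in \<open>\<ell>\<^sup>2\<close> at the inner positions.
  Its inverse Fourier transform gives the coefficients with respect to \<open>psi X\<close>.
\<close>
definition frequency_data :: "(nat \<Rightarrow> 'a::complex_banach) \<Rightarrow> 'a \<times> ell2 \<Rightarrow> nat \<Rightarrow> complex" where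
  "frequency_data X z p =
     (if p \<in> inner_positions then spread (snd z) p else coeffs X (fst z) (level p))"

definition psi_coeffs :: "(nat \<Rightarrow> 'a::complex_banach) \<Rightarrow> 'a \<times> ell2 \<Rightarrow> nat \<Rightarrow> complex" where
  "psi_coeffs X z m = (\<Sum>p\<in>block (level m). frequency_data X z p * cnj (fourier m p))"

lemma fourier_transform_psi_coeffs: "fourier_transform (psi_coeffs X z) p = frequency_data X z p"
  unfolding psi_coeffs_def by (rule fourier_transform_of_inverse)

lemma frequency_data_first [simp]: "frequency_data X z (first k) = coeffs X (fst z) k"
  by (simp add: frequency_data_def inner_positions_def)

lemma block_mean_psi_coeffs: "block_mean (psi_coeffs X z) k = coeffs X (fst z) k"
  by (simp add: block_mean_eq fourier_transform_psi_coeffs)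

text \<open>
  The contribution of the \<open>\<ell>\<^sup>2\<close> component to the coefficients.  The other component contributes a
  constant in each block, its coefficient along \<open>X k\<close> divided by \<open>sqrt (2 ^ k)\<close>.
\<close>
definition fluctuation :: "ell2 \<Rightarrow> nat \<Rightarrow> complex" where
  "fluctuation y m = (\<Sum>p\<in>block (level m). spread y p * cnj (fourier m p))"

lemma psi_coeffs_split:
  "psi_coeffs X z m = coeffs X (fst z) (level m) / of_real (sqrt (2 ^ level m)) + fluctuation (snd z) m"
proof -
  let ?B = "block (level m)" and ?f = "first (level m)"
  have "psi_coeffs X z m = coeffs X (fst z) (level m) * cnj (fourier m ?f)
      + (\<Sum>p\<in>?B - {?f}. frequency_data X z p * cnj (fourier m p))"
    unfolding psi_coeffs_def by (subst sum.remove[of _ ?f]) auto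
  also have "(\<Sum>p\<in>?B - {?f}. frequency_data X z p * cnj (fourier m p))
      = (\<Sum>p\<in>?B - {?f}. spread (snd z) p * cnj (fourier m p))"
    by (intro sum.cong) (auto simp: frequency_data_def inner_positions_def)
  also have "\<dots> = fluctuation (snd z) m"
    unfolding fluctuation_def by (subst (2) sum.remove[of _ ?f]) auto
  finally show ?thesis by (simp add: fourier_first)
qed

lemma fluctuation_energy:
  "(\<Sum>m\<in>block k. (cmod (fluctuation y m))\<^sup>2) = (\<Sum>p\<in>block k. (cmod (spread y p))\<^sup>2)"
proof -
  have "fourier_transform (fluctuation y) p = spread y p" for p
    unfolding fluctuation_def by (rule fourier_transform_of_inverse)
  then show ?thesis using fourier_parseval[of "fluctuation y" k] by simp
qed

lemma summable_fluctuation: "summable (\<lambda>m. (cmod (fluctuation y m))\<^sup>2)"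
proof (rule summableI_nonneg_bounded)
  fix n
  have "(\<Sum>m<n. (cmod (fluctuation y m))\<^sup>2) \<le> (\<Sum>m<first n. (cmod (fluctuation y m))\<^sup>2)"
    using le_first[of n] by (intro sum_mono2) auto
  also have "\<dots> = (\<Sum>p<first n. (cmod (spread y p))\<^sup>2)"
    by (simp add: sum_up_to_level fluctuation_energy)
  also have "\<dots> \<le> (norm y)\<^sup>2"
    using sum_le_suminf[OF sums_summable[OF spread_sums[of y]], of "{..<first n}"]
    by (simp add: sums_unique[OF spread_sums[of y], symmetric])
  finally show "(\<Sum>m<n. (cmod (fluctuation y m))\<^sup>2) \<le> (norm y)\<^sup>2" .
qed auto

lemma block_energy:
  "(\<Sum>m\<in>block k. (cmod (psi_coeffs X z m))\<^sup>2)
     = (cmod (coeffs X (fst z) k))\<^sup>2 + (\<Sum>p\<in>block k. (cmod (spread (snd z) p))\<^sup>2)"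
proof -
  have "(\<Sum>m\<in>block k. (cmod (psi_coeffs X z m))\<^sup>2) = (\<Sum>p\<in>block k. (cmod (frequency_data X z p))\<^sup>2)"
    using fourier_parseval[of "psi_coeffs X z" k] by (simp add: fourier_transform_psi_coeffs)
  also have "\<dots> = (cmod (coeffs X (fst z) k))\<^sup>2 + (\<Sum>p\<in>block k - {first k}. (cmod (frequency_data X z p))\<^sup>2)"
    by (subst sum.remove[of _ "first k"]) auto
  also have "(\<Sum>p\<in>block k - {first k}. (cmod (frequency_data X z p))\<^sup>2)
    = (\<Sum>p\<in>block k - {first k}. (cmod (spread (snd z) p))\<^sup>2)"
    by (intro sum.cong) (auto simp: frequency_data_def inner_positions_def)
  also have "\<dots> = (\<Sum>p\<in>block k. (cmod (spread (snd z) p))\<^sup>2)"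
    by (subst (2) sum.remove[of _ "first k"]) auto
  finally show ?thesis .
qed

lemma coeffs_tendsto_0:
  assumes "schauder_basis X" "\<And>k. norm (X k) = 1"
  shows "coeffs X x \<longlonglongrightarrow> 0"
proof -
  have "(\<lambda>k. norm (coeffs X x k *\<^sub>C X k)) \<longlonglongrightarrow> 0"
    using summable_LIMSEQ_zero[OF sums_summable[OF coeffs_sums[OF assms(1)]]]
    by (rule tendsto_norm_zero)
  then show ?thesis by (simp add: norm_scaleC assms(2) tendsto_norm_zero_iff)
qed

text \<open>
  Inside a single block the weighted sum in the basic estimate is dominated by the \<open>\<ell>\<^sup>2\<close> norm, by
  the Cauchy-Schwarz inequality.  Incomplete blocks in a partial sum are therefore harmless.
\<close>
lemma norm_sum_psi_block_le:
  assumes X: "\<And>k. norm (X k) = 1" and F: "F \<subseteq> block k"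
  shows "norm (\<Sum>m\<in>F. c m *\<^sub>C psi X m) \<le> 2 * sqrt (\<Sum>m\<in>block k. (cmod (c m))\<^sup>2)"
proof -
  let ?E = "\<Sum>m\<in>block k. (cmod (c m))\<^sup>2"
  have fin: "finite F" by (rule finite_subset[OF F finite_block])
  have E: "(\<Sum>m\<in>F. (cmod (c m))\<^sup>2) \<le> ?E"
    by (rule sum_mono2) (use F in auto)
  have "(\<Sum>m\<in>F. cmod (c m) / sqrt (2 ^ level m)) \<le> sqrt ?E"
  proof (rule real_le_rsqrt)
    have "(\<Sum>m\<in>F. cmod (c m) / sqrt (2 ^ level m))\<^sup>2 = (\<Sum>m\<in>F. cmod (c m) * (1 / sqrt (2 ^ k)))\<^sup>2"
      using F by (intro arg_cong[of _ _ "\<lambda>x. x\<^sup>2"] sum.cong) (auto simp: subset_eq)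
    also have "\<dots> \<le> (\<Sum>m\<in>F. (cmod (c m))\<^sup>2) * (\<Sum>m\<in>F. (1 / sqrt (2 ^ k))\<^sup>2)"
      by (rule Cauchy_Schwarz_ineq_sum)
    also have "\<dots> \<le> ?E * 1"
    proof (intro mult_mono E sum_nonneg)
      have "real (card F) \<le> real (2 ^ k)"
        using card_mono[OF finite_block F] by (simp only: of_nat_le_iff card_block)
      then show "(\<Sum>m\<in>F. (1 / sqrt (2 ^ k))\<^sup>2) \<le> (1::real)"
        by (simp add: power_divide)
    qed auto
    finally show "(\<Sum>m\<in>F. cmod (c m) / sqrt (2 ^ level m))\<^sup>2 \<le> ?E" by simp
  qed
  moreover have "sqrt (\<Sum>m\<in>F. (cmod (c m))\<^sup>2) \<le> sqrt ?E" using E by simp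
  ultimately show ?thesis using norm_sum_psi_le[where X = X, OF X fin, of c] by linarith
qed

text \<open>
  After complete blocks the partial sums are truncations of the two components and so converge.
  The remaining incomplete block is bounded by its energy, which tends to zero.
\<close>
lemma psi_expansion:
  assumes B: "schauder_basis X" and X: "\<And>k. norm (X k) = 1"
  shows "(\<lambda>m. psi_coeffs X z m *\<^sub>C psi X m) sums z"
proof -
  let ?c = "psi_coeffs X z"
  define s where "s n = (\<Sum>m<n. ?c m *\<^sub>C psi X m)" for n
  define f where "f p = (cmod (spread (snd z) p))\<^sup>2" for p
  have fsums: "f sums (norm (snd z))\<^sup>2" unfolding f_def by (rule spread_sums)
  have flim: "(\<lambda>K. \<Sum>p<first K. f p) \<longlonglongrightarrow> (norm (snd z))\<^sup>2"
    using filterlim_compose[OF fsums[unfolded sums_def] LIMSEQ_first] by (simp add: o_def)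
  have "(\<lambda>K. fst (s (first K))) \<longlonglongrightarrow> fst z"
    using coeffs_sums[OF B, of "fst z"]
    by (simp add: s_def fst_sum_psi block_mean_psi_coeffs sums_def)
  moreover have "(\<lambda>K. snd (s (first K))) \<longlonglongrightarrow> snd z"
  proof -
    have "(norm (snd z - snd (s (first K))))\<^sup>2 = (norm (snd z))\<^sup>2 - (\<Sum>p<first K. f p)" for K
    proof -
      have "spread (snd z - snd (s (first K))) p = (if level p < K then 0 else spread (snd z) p)" for p
        by (auto simp: spread_diff s_def spread_snd_sum_psi fourier_transform_psi_coeffs
            frequency_data_def spread_off)
      then have "(\<lambda>p. f p - (if p \<in> {..<first K} then f p else 0)) sums (norm (snd z - snd (s (first K))))\<^sup>2"
        using spread_sums[of "snd z - snd (s (first K))"]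
        by (simp add: f_def level_less_iff if_distrib[of "\<lambda>x. (cmod x)\<^sup>2"] if_distrib[of "\<lambda>x. _ - x"]
            cong: if_cong)
      moreover have "(\<lambda>p. f p - (if p \<in> {..<first K} then f p else 0)) sums
          ((norm (snd z))\<^sup>2 - (\<Sum>p<first K. f p))"
        by (intro sums_diff fsums sums_If_finite_set) simp
      ultimately show ?thesis by (rule sums_unique2)
    qed
    then have "(\<lambda>K. (norm (snd z - snd (s (first K))))\<^sup>2) \<longlonglongrightarrow> 0"
      using tendsto_diff[OF tendsto_const flim, of "(norm (snd z))\<^sup>2"] by simp
    then have "(\<lambda>K. snd z - snd (s (first K))) \<longlonglongrightarrow> 0"
      using tendsto_real_sqrt by (fastforce simp: tendsto_norm_zero_iff)
    from tendsto_diff[OF tendsto_const[of "snd z"] this] show ?thesis by simp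
  qed
  ultimately have "(\<lambda>K. (fst (s (first K)), snd (s (first K)))) \<longlonglongrightarrow> (fst z, snd z)"
    by (rule tendsto_Pair)
  then have slim: "(\<lambda>K. s (first K)) \<longlonglongrightarrow> z" by simp
  define E where "E k = (\<Sum>m\<in>block k. (cmod (?c m))\<^sup>2)" for k
  have "E \<longlonglongrightarrow> 0"
  proof -
    have "(\<Sum>p<first (Suc k). f p) - (\<Sum>p<first k. f p) = (\<Sum>p\<in>block k. f p)" for k
      by (simp add: sum_up_to_level)
    then have "(\<lambda>k. \<Sum>p\<in>block k. f p) \<longlonglongrightarrow> (norm (snd z))\<^sup>2 - (norm (snd z))\<^sup>2"
      using tendsto_diff[OF LIMSEQ_Suc[OF flim] flim] by simp
    moreover have "(\<lambda>k. (cmod (coeffs X (fst z) k))\<^sup>2) \<longlonglongrightarrow> 0"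
      using tendsto_power[OF tendsto_norm[OF coeffs_tendsto_0[OF B X, of "fst z"]], of 2] by simp
    ultimately show ?thesis
      unfolding E_def block_energy using tendsto_add by (fastforce simp: f_def)
  qed
  have tail: "norm (s n - s (first (level n))) \<le> 2 * sqrt (E (level n))" for n
  proof -
    have le: "first (level n) \<le> n" using level_less_iff[of n "level n"] by simp
    have "m \<in> block (level n)" if "m \<in> {first (level n)..<n}" for m
      using that level_bounds(2)[of n] Suc_first[of "Suc (level n)"]
      by (auto simp: block_def simp del: mem_block_iff)
    then have sub: "{first (level n)..<n} \<subseteq> block (level n)" by blast
    have "s n - s (first (level n)) = (\<Sum>m\<in>{first (level n)..<n}. ?c m *\<^sub>C psi X m)"
      unfolding s_def using sum_diff_nat_ivl[OF _ le, of 0 "\<lambda>m. ?c m *\<^sub>C psi X m"]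
      by (simp add: atLeast0LessThan)
    then show ?thesis using norm_sum_psi_block_le[where X = X, OF X sub, of ?c] by (simp add: E_def)
  qed
  have "(\<lambda>n. 2 * sqrt (E (level n))) \<longlonglongrightarrow> 2 * sqrt 0"
    by (rule tendsto_mult[OF tendsto_const tendsto_real_sqrt])
      (rule filterlim_compose[OF \<open>E \<longlonglongrightarrow> 0\<close> LIMSEQ_level])
  then have lim0: "(\<lambda>n. 2 * sqrt (E (level n))) \<longlonglongrightarrow> 0" by simp
  have "(\<lambda>n. s n - s (first (level n))) \<longlonglongrightarrow> 0"
    by (rule Lim_null_comparison[OF _ lim0]) (simp add: tail)
  from tendsto_add[OF this filterlim_compose[OF slim LIMSEQ_level]]
  show ?thesis by (simp add: sums_def s_def)
qed

text \<open>
  The Fourier transform of any coefficient sequence of \<open>z\<close> is read off from \<open>z\<close>: at \<open>first k\<close> by the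
  uniqueness of expansions in \<open>X\<close>, at inner positions by the continuity of coordinates in \<open>\<ell>\<^sup>2\<close>.
\<close>
lemma psi_expansion_unique:
  assumes B: "schauder_basis X"
    and sums: "(\<lambda>m. c m *\<^sub>C psi X m) sums z"
  shows "c = psi_coeffs X z"
proof -
  define s where "s K = (\<Sum>m<first K. c m *\<^sub>C psi X m)" for K
  have s: "s \<longlonglongrightarrow> z"
    unfolding s_def using filterlim_compose[OF sums[unfolded sums_def] LIMSEQ_first] by simp
  have "(\<lambda>k. block_mean c k *\<^sub>C X k) sums fst z"
    using tendsto_fst[OF s] by (simp add: s_def fst_sum_psi sums_def)
  then have mean: "coeffs X (fst z) = block_mean c" by (rule coeffs_eqI[OF B])
  have ft: "fourier_transform c p = frequency_data X z p" for p
  proof (cases "p \<in> inner_positions")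
    case True
    have "(\<lambda>K. spread (snd (s K)) p) \<longlonglongrightarrow> spread (snd z) p"
    proof -
      have null: "(\<lambda>K. spread (snd z) p - spread (snd (s K)) p) \<longlonglongrightarrow> 0"
      proof (rule Lim_null_comparison)
        show "\<forall>\<^sub>F K in sequentially. norm (spread (snd z) p - spread (snd (s K)) p)
          \<le> norm (snd z - snd (s K))"
          by (simp add: norm_spread_le flip: spread_diff)
        show "(\<lambda>K. norm (snd z - snd (s K))) \<longlonglongrightarrow> 0"
          using tendsto_norm[OF tendsto_diff[OF tendsto_const tendsto_snd[OF s], of "snd z"]] by simp
      qed
      from tendsto_diff[OF tendsto_const[of "spread (snd z) p"] null] show ?thesis by simp
    qed
    moreover have "(\<lambda>K. spread (snd (s K)) p) \<longlonglongrightarrow> fourier_transform c p"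
    proof (rule tendsto_eventually)
      show "\<forall>\<^sub>F K in sequentially. spread (snd (s K)) p = fourier_transform c p"
        using True by (intro eventually_sequentiallyI[of "Suc (level p)"])
          (simp add: s_def spread_snd_sum_psi)
    qed
    ultimately show ?thesis using True LIMSEQ_unique by (auto simp: frequency_data_def)
  next
    case False
    then have "p = first (level p)" by (simp add: inner_positions_def)
    then show ?thesis using mean by (metis block_mean_eq frequency_data_first)
  qed
  show ?thesis
  proof
    fix m
    show "c m = psi_coeffs X z m"
      using fourier_transform_inverse[of c m] by (simp add: ft psi_coeffs_def)
  qed
qed

theorem schauder_basis_psi:
  assumes "schauder_basis X" "\<And>k. norm (X k) = 1"
  shows "schauder_basis (psi X)"
  unfolding schauder_basis_def
  using psi_expansion[OF assms] psi_expansion_unique[OF assms(1)] by blast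

lemma coeffs_psi:
  assumes "schauder_basis X" "\<And>k. norm (X k) = 1"
  shows "coeffs (psi X) z = psi_coeffs X z"
  by (rule coeffs_eqI[OF schauder_basis_psi[OF assms] psi_expansion[OF assms]])


section \<open>Greedy approximation\<close>

lemma sum_level_weights:
  "(\<Sum>m<first K. 1 / sqrt (2 ^ level m)) \<le> 3 * sqrt (2 ^ K)"
proof -
  have "4 / 3 \<le> sqrt 2" by (rule real_le_rsqrt) (simp add: power2_eq_square)
  then have step: "4 * sqrt (2 ^ K) \<le> 3 * sqrt (2 ^ Suc K)" for K
    using mult_right_mono[of "4/3" "sqrt 2" "sqrt (2 ^ K)"] by (simp add: real_sqrt_mult)
  have "(\<Sum>m<first K. 1 / sqrt (2 ^ level m)) = (\<Sum>k<K. sqrt (2 ^ k))"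
    unfolding sum_up_to_level[of "\<lambda>m. 1 / sqrt (2 ^ level m)"]
    by (intro sum.cong) (simp_all add: real_div_sqrt)
  also have "\<dots> \<le> 3 * sqrt (2 ^ K)"
  proof (induction K)
    case (Suc K)
    then show ?case using step[of K] by simp
  qed simp
  finally show ?thesis .
qed

text \<open>
  Coefficients of size at most \<open>t\<close> below level \<open>K\<close>: both terms of the basic estimate are geometric
  sums dominated by their last term, of order \<open>t * sqrt (2 ^ K)\<close>.
\<close>
lemma norm_sum_psi_low_levels_le:
  assumes X: "\<And>k. norm (X k) = 1" and F: "F \<subseteq> {..<first K}"
    and t: "\<And>m. m \<in> F \<Longrightarrow> cmod (c m) \<le> t" "t \<ge> 0"
  shows "norm (\<Sum>m\<in>F. c m *\<^sub>C psi X m) \<le> 4 * (t * sqrt (2 ^ K))"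
proof -
  have fin: "finite F" by (rule finite_subset[OF F]) simp
  have "(\<Sum>m\<in>F. cmod (c m) / sqrt (2 ^ level m)) \<le> (\<Sum>m\<in>F. t * (1 / sqrt (2 ^ level m)))"
    using t by (intro sum_mono) (simp add: divide_right_mono)
  also have "\<dots> \<le> (\<Sum>m<first K. t * (1 / sqrt (2 ^ level m)))"
    using F t by (intro sum_mono2) auto
  also have "\<dots> = t * (\<Sum>m<first K. 1 / sqrt (2 ^ level m))"
    by (simp only: sum_distrib_left)
  also have "\<dots> \<le> t * (3 * sqrt (2 ^ K))"
    by (rule mult_left_mono[OF sum_level_weights t(2)])
  finally have 1: "(\<Sum>m\<in>F. cmod (c m) / sqrt (2 ^ level m)) \<le> 3 * (t * sqrt (2 ^ K))" by simp
  have "(\<Sum>m\<in>F. (cmod (c m))\<^sup>2) \<le> (\<Sum>m\<in>F. t\<^sup>2)"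
    using t by (intro sum_mono power_mono) auto
  also have "\<dots> \<le> (\<Sum>m<first K. t\<^sup>2)"
    using F by (intro sum_mono2) auto
  also have "\<dots> \<le> 2 ^ K * t\<^sup>2"
  proof -
    have "real (first K) \<le> real (2 ^ K)" unfolding of_nat_le_iff by (simp add: first_def)
    then show ?thesis by (simp add: mult_right_mono)
  qed
  finally have "sqrt (\<Sum>m\<in>F. (cmod (c m))\<^sup>2) \<le> sqrt (2 ^ K * t\<^sup>2)" by simp
  also have "\<dots> = t * sqrt (2 ^ K)" using t(2) by (simp add: real_sqrt_mult)
  finally show ?thesis using norm_sum_psi_le[where X = X, OF X fin, of c] 1 by linarith
qed

text \<open>
  Coefficients of size at least \<open>t\<close> from level \<open>K\<close> on: here \<open>cmod a \<le> (cmod a)\<^sup>2 / t\<close>, and the weights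
  are at most \<open>1 / sqrt (2 ^ K)\<close>.
\<close>
lemma norm_sum_psi_high_levels_le:
  assumes X: "\<And>k. norm (X k) = 1" and F: "finite F" "\<And>m. m \<in> F \<Longrightarrow> K \<le> level m"
    and t: "\<And>m. m \<in> F \<Longrightarrow> t \<le> cmod (c m)" "t > 0"
    and E: "(\<Sum>m\<in>F. (cmod (c m))\<^sup>2) \<le> E"
  shows "norm (\<Sum>m\<in>F. c m *\<^sub>C psi X m) \<le> E / (t * sqrt (2 ^ K)) + sqrt E"
proof -
  have "(\<Sum>m\<in>F. cmod (c m) / sqrt (2 ^ level m)) \<le> (\<Sum>m\<in>F. (cmod (c m))\<^sup>2 / (t * sqrt (2 ^ K)))"
  proof (intro sum_mono)
    fix m assume m: "m \<in> F"
    have "cmod (c m) / sqrt (2 ^ level m) \<le> cmod (c m) / sqrt (2 ^ K)"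
      using F(2)[OF m] by (intro divide_left_mono) auto
    also have "\<dots> = t * cmod (c m) / (t * sqrt (2 ^ K))" using t(2) by simp
    also have "\<dots> \<le> (cmod (c m))\<^sup>2 / (t * sqrt (2 ^ K))"
      using t(1)[OF m] t(2) by (intro divide_right_mono) (auto simp: power2_eq_square mult_right_mono)
    finally show "cmod (c m) / sqrt (2 ^ level m) \<le> (cmod (c m))\<^sup>2 / (t * sqrt (2 ^ K))" .
  qed
  also have "\<dots> = (\<Sum>m\<in>F. (cmod (c m))\<^sup>2) / (t * sqrt (2 ^ K))" by (simp only: sum_divide_distrib)
  also have "\<dots> \<le> E / (t * sqrt (2 ^ K))" using E t(2) by (intro divide_right_mono) auto
  finally have "(\<Sum>m\<in>F. cmod (c m) / sqrt (2 ^ level m)) \<le> E / (t * sqrt (2 ^ K))" .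
  moreover have "sqrt (\<Sum>m\<in>F. (cmod (c m))\<^sup>2) \<le> sqrt E" using E by simp
  ultimately show ?thesis using norm_sum_psi_le[where X = X, OF X F(1), of c] by linarith
qed

lemma summable_finite_tail:
  fixes f :: "nat \<Rightarrow> real"
  assumes "summable f" "\<And>n. f n \<ge> 0" "e > 0"
  obtains N where "\<And>F. finite F \<Longrightarrow> F \<subseteq> {N..} \<Longrightarrow> sum f F \<le> e"
proof -
  obtain N where N: "\<And>m n. m \<ge> N \<Longrightarrow> norm (sum f {m..<n}) < e"
    using assms(1,3) unfolding summable_Cauchy by blast
  have "sum f F \<le> e" if F: "finite F" "F \<subseteq> {N..}" for F
  proof -
    obtain n where "F \<subseteq> {..<n}" using F(1) finite_nat_iff_bounded by blast
    then have "sum f F \<le> sum f {N..<n}" using F assms(2) by (intro sum_mono2) auto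
    then show ?thesis using N[of N n] by simp
  qed
  then show ?thesis by (rule that)
qed

text \<open>
  Put \<open>J = {..<first K}\<close>, where \<open>K\<close> is chosen such that \<open>t * sqrt (2 ^ K)\<close> is comparable with \<open>\<delta>\<close>.
  The sum over \<open>\<Lambda>\<close> differs from the partial sum over \<open>J\<close>, which approximates \<open>z\<close>, by the small
  coefficients in \<open>J - \<Lambda>\<close> and the large coefficients in \<open>\<Lambda> - J\<close>.  The former are controlled by the
  choice of \<open>K\<close>.  The latter consist mainly of the fluctuation, which has a small \<open>\<ell>\<^sup>2\<close> tail.
\<close>
lemma thresholding_approximates:
  assumes B: "schauder_basis X" and X: "\<And>k. norm (X k) = 1" and \<delta>: "\<delta> > 0"
  obtains \<eta> where "\<eta> > 0"
    "\<And>t \<Lambda>. 0 < t \<Longrightarrow> t < \<eta> \<Longrightarrow> finite \<Lambda> \<Longrightarrow>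
      (\<And>m. m \<in> \<Lambda> \<Longrightarrow> t \<le> cmod (psi_coeffs X z m)) \<Longrightarrow>
      (\<And>m. m \<notin> \<Lambda> \<Longrightarrow> cmod (psi_coeffs X z m) \<le> t) \<Longrightarrow>
      norm (z - (\<Sum>m\<in>\<Lambda>. psi_coeffs X z m *\<^sub>C psi X m)) \<le> 11 * \<delta>"
proof -
  let ?c = "psi_coeffs X z" and ?b = "coeffs X (fst z)"
  define s where "s F = (\<Sum>m\<in>F. ?c m *\<^sub>C psi X m)" for F
  obtain K1 where K1: "\<And>k. k \<ge> K1 \<Longrightarrow> cmod (?b k) < \<delta> / 2"
    using LIMSEQ_D[OF coeffs_tendsto_0[where X = X, OF B X, of "fst z"], of "\<delta> / 2"] \<delta> by auto
  obtain K2 where K2: "\<And>n. n \<ge> K2 \<Longrightarrow> norm (s {..<n} - z) < \<delta>"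
    using LIMSEQ_D[OF psi_expansion[where X = X, OF B X, of z, unfolded sums_def] \<delta>]
    by (auto simp: s_def)
  obtain K3 where K3: "\<And>F. finite F \<Longrightarrow> F \<subseteq> {K3..} \<Longrightarrow>
      (\<Sum>m\<in>F. (cmod (fluctuation (snd z) m))\<^sup>2) \<le> \<delta>\<^sup>2 / 4"
    using summable_finite_tail[OF summable_fluctuation[of "snd z"], of "\<delta>\<^sup>2 / 4"] \<delta> by auto
  define K0 where "K0 = K1 + K2 + K3"
  have main: "norm (z - s \<Lambda>) \<le> 11 * \<delta>"
    if t: "0 < t" "t < \<delta> / sqrt (2 ^ K0)" and fin: "finite \<Lambda>"
      and big: "\<And>m. m \<in> \<Lambda> \<Longrightarrow> t \<le> cmod (?c m)"
      and small: "\<And>m. m \<notin> \<Lambda> \<Longrightarrow> cmod (?c m) \<le> t" for t \<Lambda>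
  proof -
    \<comment> \<open>the level at which the threshold \<open>t\<close> balances the coefficients: \<open>t * sqrt (2 ^ K) \<approx> \<delta>\<close>\<close>
    define K where "K = (LEAST K. \<delta> \<le> t * sqrt (2 ^ K))"
    have ex: "\<exists>K. \<delta> \<le> t * sqrt (2 ^ K)"
    proof -
      obtain n where "\<delta> / t < sqrt 2 ^ n"
        using real_arch_pow[of "sqrt 2" "\<delta> / t"] by auto
      then show ?thesis using t(1) by (auto simp: field_simps real_sqrt_power intro!: exI[of _ n])
    qed
    have K: "\<delta> \<le> t * sqrt (2 ^ K)" unfolding K_def by (rule LeastI_ex[OF ex])
    have K0: "K0 < K"
    proof (rule ccontr)
      assume "\<not> K0 < K"
      then have "t * sqrt (2 ^ K) \<le> t * sqrt (2 ^ K0)" using t(1) by simp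
      also have "\<dots> < \<delta>" using t(2) by (simp add: field_simps)
      finally show False using K by simp
    qed
    have K': "t * sqrt (2 ^ K) \<le> 2 * \<delta>"
    proof -
      obtain K' where K': "K = Suc K'" using K0 by (cases K) auto
      then have "t * sqrt (2 ^ K') < \<delta>"
        unfolding K_def by (metis K' K_def lessI not_le not_less_Least)
      moreover have "t * sqrt (2 ^ K) = sqrt 2 * (t * sqrt (2 ^ K'))" by (simp add: K' real_sqrt_mult)
      moreover have "sqrt 2 * (t * sqrt (2 ^ K')) \<le> 2 * (t * sqrt (2 ^ K'))"
        using t(1) by (intro mult_right_mono real_le_lsqrt) auto
      ultimately show ?thesis by linarith
    qed
    define J where "J = {..<first K}"
    have J: "norm (s J - z) < \<delta>"
      unfolding J_def using K0 le_first[of K] by (intro K2) (simp add: K0_def)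
    have low: "norm (s (J - \<Lambda>)) \<le> 8 * \<delta>"
    proof -
      have "norm (s (J - \<Lambda>)) \<le> 4 * (t * sqrt (2 ^ K))"
        unfolding s_def using small t(1) by (intro norm_sum_psi_low_levels_le X) (auto simp: J_def)
      then show ?thesis using K' by linarith
    qed
    have high: "norm (s (\<Lambda> - J)) \<le> 2 * \<delta>"
    proof -
      have lev: "K \<le> level m" if "m \<in> \<Lambda> - J" for m
        using that by (simp add: J_def flip: level_less_iff)
      \<comment> \<open>above level \<open>K\<close> the first component contributes at most half of a large coefficient\<close>
      have half: "cmod (?c m) \<le> 2 * cmod (fluctuation (snd z) m)" if m: "m \<in> \<Lambda> - J" for m
      proof -
        have "sqrt (2 ^ K) * cmod (?b (level m) / of_real (sqrt (2 ^ level m)))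
          \<le> sqrt (2 ^ level m) * cmod (?b (level m) / of_real (sqrt (2 ^ level m)))"
          using lev[OF m] by (intro mult_right_mono) auto
        also have "\<dots> = cmod (?b (level m))" by (simp add: norm_divide)
        also have "\<dots> \<le> \<delta> / 2" using lev[OF m] K0 by (intro less_imp_le K1) (simp add: K0_def)
        also have "\<dots> \<le> sqrt (2 ^ K) * (t / 2)" using K by (simp add: mult.commute)
        finally have "cmod (?b (level m) / of_real (sqrt (2 ^ level m))) \<le> t / 2"
          by (rule mult_left_le_imp_le) simp
        moreover have "cmod (?c m) \<le> cmod (?b (level m) / of_real (sqrt (2 ^ level m)))
            + cmod (fluctuation (snd z) m)"
          unfolding psi_coeffs_split by (rule norm_triangle_ineq)
        moreover have "t \<le> cmod (?c m)" using big m by blast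
        ultimately show ?thesis by linarith
      qed
      have "(\<Sum>m\<in>\<Lambda> - J. (cmod (?c m))\<^sup>2) \<le> (\<Sum>m\<in>\<Lambda> - J. 4 * (cmod (fluctuation (snd z) m))\<^sup>2)"
      proof (intro sum_mono)
        fix m assume "m \<in> \<Lambda> - J"
        then have "(cmod (?c m))\<^sup>2 \<le> (2 * cmod (fluctuation (snd z) m))\<^sup>2"
          using half by (intro power_mono) auto
        then show "(cmod (?c m))\<^sup>2 \<le> 4 * (cmod (fluctuation (snd z) m))\<^sup>2"
          by (simp add: power_mult_distrib)
      qed
      also have "\<dots> = 4 * (\<Sum>m\<in>\<Lambda> - J. (cmod (fluctuation (snd z) m))\<^sup>2)"
        by (simp add: sum_distrib_left)
      also have "\<dots> \<le> 4 * (\<delta>\<^sup>2 / 4)"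
      proof (intro mult_left_mono K3)
        have "K3 \<le> first K" using K0 le_first[of K] by (simp add: K0_def)
        then show "\<Lambda> - J \<subseteq> {K3..}" by (auto simp: J_def)
      qed (use fin in auto)
      finally have "(\<Sum>m\<in>\<Lambda> - J. (cmod (?c m))\<^sup>2) \<le> \<delta>\<^sup>2" by simp
      then have "norm (s (\<Lambda> - J)) \<le> \<delta>\<^sup>2 / (t * sqrt (2 ^ K)) + sqrt (\<delta>\<^sup>2)"
        unfolding s_def using fin lev big t(1) by (intro norm_sum_psi_high_levels_le X) auto
      moreover have "\<delta>\<^sup>2 / (t * sqrt (2 ^ K)) \<le> \<delta>\<^sup>2 / \<delta>"
        using K t(1) \<delta> by (intro divide_left_mono) auto
      ultimately show ?thesis using \<delta> by (simp add: power2_eq_square)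
    qed
    have "s \<Lambda> = s (\<Lambda> \<inter> J) + s (\<Lambda> - J)" "s J = s (J \<inter> \<Lambda>) + s (J - \<Lambda>)"
      unfolding s_def using fin by (intro sum.Int_Diff; simp add: J_def)+
    then have "z - s \<Lambda> = s (J - \<Lambda>) - s (\<Lambda> - J) - (s J - z)" by (simp add: Int_commute)
    also have "norm \<dots> \<le> norm (s (J - \<Lambda>)) + norm (s (\<Lambda> - J)) + norm (s J - z)"
      using norm_triangle_ineq4[of "s (J - \<Lambda>) - s (\<Lambda> - J)" "s J - z"]
        norm_triangle_ineq4[of "s (J - \<Lambda>)" "s (\<Lambda> - J)"] by linarith
    finally show ?thesis using low high J by linarith
  qed
  show ?thesis
    by (rule that[of "\<delta> / sqrt (2 ^ K0)"]) (use \<delta> main[unfolded s_def] in auto)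
qed

lemma psi_coeffs_tendsto_0:
  assumes B: "schauder_basis X" and X: "\<And>k. norm (X k) = 1"
  shows "psi_coeffs X z \<longlonglongrightarrow> 0"
proof -
  have 1: "(\<lambda>m. coeffs X (fst z) (level m)) \<longlonglongrightarrow> 0"
    by (rule filterlim_compose[OF coeffs_tendsto_0[where X = X, OF B X] LIMSEQ_level])
  have 2: "(\<lambda>m. coeffs X (fst z) (level m) / of_real (sqrt (2 ^ level m))) \<longlonglongrightarrow> 0"
  proof (rule Lim_null_comparison[OF _ tendsto_norm_zero[OF 1]])
    have "cmod (coeffs X (fst z) (level m)) / sqrt (2 ^ level m) \<le> cmod (coeffs X (fst z) (level m)) / 1" for m
      by (intro divide_left_mono) auto
    then show "\<forall>\<^sub>F m in sequentially. norm (coeffs X (fst z) (level m) / of_real (sqrt (2 ^ level m)))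
        \<le> norm (coeffs X (fst z) (level m))"
      by (simp add: norm_divide)
  qed
  have 3: "fluctuation (snd z) \<longlonglongrightarrow> 0"
    using tendsto_real_sqrt[OF summable_LIMSEQ_zero[OF summable_fluctuation[of "snd z"]]]
    by (simp add: tendsto_norm_zero_iff)
  show ?thesis
    using tendsto_add[OF 2 3] unfolding psi_coeffs_split[abs_def] by simp
qed

text \<open>
  A greedy set is a thresholding set for its smallest selected coefficient, and this threshold
  tends to zero with the size of the set.  If the threshold is zero, the expansion is finite and
  recovered completely.
\<close>
theorem quasi_greedy_psi:
  assumes B: "schauder_basis X" and X: "\<And>k. norm (X k) = 1"
  shows "quasi_greedy (psi X)"
  unfolding quasi_greedy_def
proof (intro allI impI)
  fix z \<Lambda> assume greedy: "\<forall>N\<ge>1. greedy_set (psi X) z N (\<Lambda> N)"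
  let ?c = "psi_coeffs X z"
  have coeffs: "coeffs (psi X) z = ?c" by (rule coeffs_psi[where X = X, OF B X])
  show "(\<lambda>N. norm (z - basis_proj (psi X) (\<Lambda> N) z)) \<longlonglongrightarrow> 0"
  proof (rule LIMSEQ_I)
    fix e :: real assume e: "e > 0"
    obtain \<eta> where \<eta>: "\<eta> > 0" and approx: "\<And>t \<Lambda>. 0 < t \<Longrightarrow> t < \<eta> \<Longrightarrow> finite \<Lambda> \<Longrightarrow>
      (\<And>m. m \<in> \<Lambda> \<Longrightarrow> t \<le> cmod (?c m)) \<Longrightarrow> (\<And>m. m \<notin> \<Lambda> \<Longrightarrow> cmod (?c m) \<le> t) \<Longrightarrow>
      norm (z - (\<Sum>m\<in>\<Lambda>. ?c m *\<^sub>C psi X m)) \<le> 11 * (e / 12)"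
      using thresholding_approximates[where X = X and \<delta> = "e / 12" and z = z, OF B X] e by auto
    obtain N0 where N0: "\<And>m. m \<ge> N0 \<Longrightarrow> cmod (?c m) < \<eta>"
      using LIMSEQ_D[OF psi_coeffs_tendsto_0[where X = X, OF B X, of z] \<eta>] by auto
    have "norm (norm (z - basis_proj (psi X) (\<Lambda> N) z) - 0) < e" if N: "N \<ge> Suc N0" for N
    proof -
      have gs: "finite (\<Lambda> N)" "card (\<Lambda> N) = N"
        "\<And>j i. j \<in> \<Lambda> N \<Longrightarrow> i \<notin> \<Lambda> N \<Longrightarrow> cmod (?c i) \<le> cmod (?c j)"
        using greedy[rule_format, of N] N by (auto simp: greedy_set_def coeffs)
      have ne: "\<Lambda> N \<noteq> {}" using gs N by auto
      define t where "t = Min ((\<lambda>m. cmod (?c m)) ` \<Lambda> N)"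
      have "t \<in> (\<lambda>m. cmod (?c m)) ` \<Lambda> N" unfolding t_def using gs ne by (intro Min_in) auto
      then obtain j where j: "j \<in> \<Lambda> N" "t = cmod (?c j)" by auto
      have big: "t \<le> cmod (?c m)" if "m \<in> \<Lambda> N" for m
        unfolding t_def using that gs by (intro Min_le) auto
      have small: "cmod (?c m) \<le> t" if "m \<notin> \<Lambda> N" for m
        using gs(3) j that by auto
      have t: "t < \<eta>"
      proof (rule ccontr)
        assume "\<not> t < \<eta>"
        then have "\<Lambda> N \<subseteq> {..<N0}" using big N0 by (meson lessThan_iff linorder_not_less order_trans subsetI)
        from card_mono[OF _ this] show False using gs(2) N by simp
      qed
      have "norm (z - (\<Sum>m\<in>\<Lambda> N. ?c m *\<^sub>C psi X m)) \<le> 11 * (e / 12)"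
      proof (cases "t = 0")
        case True
        then have "(\<lambda>m. ?c m *\<^sub>C psi X m) sums (\<Sum>m\<in>\<Lambda> N. ?c m *\<^sub>C psi X m)"
          using small gs by (intro sums_finite) auto
        then have "(\<Sum>m\<in>\<Lambda> N. ?c m *\<^sub>C psi X m) = z"
          using psi_expansion[where X = X, OF B X, of z] sums_unique2 by blast
        then show ?thesis using e by simp
      next
        case False
        then have "t > 0" using j by simp
        then show ?thesis using t gs big small by (intro approx) auto
      qed
      then show ?thesis using e by (simp add: basis_proj_def coeffs)
    qed
    then show "\<exists>N0. \<forall>N\<ge>N0. norm (norm (z - basis_proj (psi X) (\<Lambda> N) z) - 0) < e" by blast
  qed
qed


section \<open>Democracy\<close>

text \<open>
  The estimates at low and high levels with \<open>t = 1\<close>, split at the level where the block size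
  \<open>2 ^ K\<close> is comparable with the cardinality of \<open>\<Lambda>\<close>.
\<close>
lemma norm_sum_psi_indicator_le:
  assumes X: "\<And>k. norm (X k) = 1" and fin: "finite \<Lambda>"
  shows "norm (\<Sum>m\<in>\<Lambda>. psi X m) \<le> 7 * sqrt (real (card \<Lambda>))"
proof (cases "\<Lambda> = {}")
  case False
  define n where "n = card \<Lambda>"
  have n: "n > 0" using False fin by (simp add: n_def card_gt_0_iff)
  define K where "K = level (n - 1)"
  have K: "2 ^ K \<le> n" "n < 2 * 2 ^ K"
    using level_bounds[of "n - 1"] n by (simp_all add: K_def)
  have Kr: "2 ^ K \<le> real n" "real n \<le> 2 * 2 ^ K"
    using of_nat_mono[OF K(1), where 'a = real] of_nat_mono[OF less_imp_le[OF K(2)], where 'a = real]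
    by simp_all
  define s where "s F = (\<Sum>m\<in>F. 1 *\<^sub>C psi X m)" for F
  have low: "norm (s (\<Lambda> \<inter> {..<first K})) \<le> 4 * sqrt (real n)"
  proof -
    have "norm (s (\<Lambda> \<inter> {..<first K})) \<le> 4 * (1 * sqrt (2 ^ K))"
      unfolding s_def by (rule norm_sum_psi_low_levels_le[OF X]) auto
    moreover have "sqrt (2 ^ K) \<le> sqrt (real n)" using Kr by simp
    ultimately show ?thesis by linarith
  qed
  have high: "norm (s (\<Lambda> - {..<first K})) \<le> 3 * sqrt (real n)"
  proof -
    have "card (\<Lambda> - {..<first K}) \<le> n" unfolding n_def using fin by (intro card_mono) auto
    then have "norm (s (\<Lambda> - {..<first K})) \<le> real n / (1 * sqrt (2 ^ K)) + sqrt (real n)"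
      unfolding s_def using fin
      by (intro norm_sum_psi_high_levels_le X) (auto simp flip: level_less_iff)
    moreover have "real n / (1 * sqrt (2 ^ K)) \<le> 2 * sqrt (real n)"
    proof -
      have "sqrt (real n) \<le> sqrt (2\<^sup>2 * 2 ^ K)"
        unfolding real_sqrt_le_iff using Kr(2) zero_le_power[of "2::real" K] by (simp del: zero_le_power)
      also have "\<dots> = 2 * sqrt (2 ^ K)" by (simp add: real_sqrt_mult)
      finally have "sqrt (real n) * sqrt (real n) \<le> sqrt (real n) * (2 * sqrt (2 ^ K))"
        by (intro mult_left_mono) auto
      then show ?thesis by (simp add: pos_divide_le_eq mult_ac)
    qed
    ultimately show ?thesis by linarith
  qed
  have "(\<Sum>m\<in>\<Lambda>. psi X m) = s (\<Lambda> \<inter> {..<first K}) + s (\<Lambda> - {..<first K})"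
    unfolding s_def using sum.Int_Diff[OF fin] by simp
  then show ?thesis
    using low high norm_triangle_ineq[of "s (\<Lambda> \<inter> {..<first K})" "s (\<Lambda> - {..<first K})"]
    by (simp add: n_def)
qed simp

lemma sum_powers_of_two_le:
  assumes "finite S" "\<And>k. k \<in> S \<Longrightarrow> 2 ^ k \<le> R" "R \<ge> (0::real)"
  shows "(\<Sum>k\<in>S. 2 ^ k) \<le> 2 * R"
proof (cases "S = {}")
  case False
  have "(\<Sum>k\<in>S. (2::real) ^ k) \<le> (\<Sum>k<Suc (Max S). 2 ^ k)"
    using assms(1) by (intro sum_mono2) (auto simp: less_Suc_eq_le)
  also have "\<dots> \<le> 2 * 2 ^ Max S"
    by (subst geometric_sum) auto
  also have "\<dots> \<le> 2 * R" using assms(2)[OF Max_in[OF assms(1) False]] by simp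
  finally show ?thesis .
qed (use assms in simp)

lemma coeffs_finite_sum:
  assumes B: "schauder_basis X"
  shows "coeffs X (\<Sum>k<K. b k *\<^sub>C X k) = (\<lambda>k. if k < K then b k else 0)"
proof (rule coeffs_eqI[OF B])
  have "(\<lambda>k. (if k < K then b k else 0) *\<^sub>C X k) sums (\<Sum>k<K. (if k < K then b k else 0) *\<^sub>C X k)"
    by (rule sums_finite) auto
  then show "(\<lambda>k. (if k < K then b k else 0) *\<^sub>C X k) sums (\<Sum>k<K. b k *\<^sub>C X k)" by simp
qed

text \<open>
  In a block of which at most half is occupied, at least half of the energy lies in the \<open>\<ell>\<^sup>2\<close>
  component.  In the other blocks the coefficient along \<open>X k\<close> is at least \<open>sqrt (2 ^ k) / 2\<close>, so the
  norm bounds the size of the largest of them, and with it their total size.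
\<close>
lemma norm_sum_psi_indicator_ge:
  assumes B: "schauder_basis X" and X: "\<And>k. norm (X k) = 1"
  obtains c where "0 < c" "c \<le> 1"
    "\<And>\<Lambda>. finite \<Lambda> \<Longrightarrow> c * sqrt (real (card \<Lambda>)) \<le> norm (\<Sum>m\<in>\<Lambda>. psi X m)"
proof -
  obtain M where M: "M > 0" "\<And>j x. norm (coeffs X x j *\<^sub>C X j) \<le> M * norm x"
    using norm_coeffs_term_bounded[OF B] by blast
  \<comment> \<open>\<open>2\<close> accounts for the blocks filled at most by half, \<open>8 * M\<^sup>2\<close> for the others\<close>
  define C where "C = 2 + 8 * M\<^sup>2"
  have C: "C \<ge> 1" by (simp add: C_def)
  have main: "real (card \<Lambda>) \<le> C * (norm (\<Sum>m\<in>\<Lambda>. psi X m))\<^sup>2" if fin: "finite \<Lambda>" for \<Lambda>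
  proof -
    define z where "z = (\<Sum>m\<in>\<Lambda>. psi X m)"
    obtain K where K: "\<Lambda> \<subseteq> {..<first K}" using finite_below_first[OF fin] by blast
    define c :: "nat \<Rightarrow> complex" where "c m = (if m \<in> \<Lambda> then 1 else 0)" for m
    define n where "n k = real (card (\<Lambda> \<inter> block k))" for k
    have z: "z = (\<Sum>m<first K. c m *\<^sub>C psi X m)"
      using sum_psi_restrict[OF K, of "\<lambda>_. 1" X] by (simp add: z_def c_def)
    have mean: "block_mean c k = of_real (n k / sqrt (2 ^ k))" for k
    proof -
      have "(\<Sum>m\<in>block k. c m) = of_nat (card (\<Lambda> \<inter> block k))"
        by (simp add: c_def sum.If_cases Int_commute flip: Collect_conj_eq)
      then show ?thesis by (simp add: block_mean_def n_def)
    qed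
    have energy: "(\<Sum>m\<in>block k. (cmod (c m))\<^sup>2) = n k" for k
    proof -
      have "(cmod (c m))\<^sup>2 = (if m \<in> \<Lambda> then 1 else 0)" for m by (simp add: c_def)
      then show ?thesis by (simp add: n_def sum.If_cases Int_commute)
    qed
    have nonneg: "n k \<ge> 0" for k by (simp add: n_def)
    have nle: "n k \<le> 2 ^ k" for k
    proof -
      have "card (\<Lambda> \<inter> block k) \<le> card (block k)" by (intro card_mono) auto
      then have "n k \<le> real (2 ^ k)" unfolding n_def of_nat_le_iff by (simp only: card_block)
      then show ?thesis by simp
    qed
    have card: "real (card \<Lambda>) = (\<Sum>k<K. n k)"
    proof -
      have "(\<Sum>m<first K. (cmod (c m))\<^sup>2) = (\<Sum>m\<in>\<Lambda>. 1)"
        using K by (intro sum.mono_neutral_cong_right) (auto simp: c_def)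
      then show ?thesis by (simp add: sum_up_to_level energy)
    qed
    have snd: "(norm (snd z))\<^sup>2 = (\<Sum>k<K. n k - (n k)\<^sup>2 / 2 ^ k)"
      unfolding z norm_snd_sum_psi sum_up_to_level[of "\<lambda>m. (cmod (c m))\<^sup>2"] energy mean
      using nonneg by (simp add: norm_divide power_divide sum_subtractf)
    \<comment> \<open>coefficient functionals of \<open>X\<close> are bounded, so well filled blocks cannot lie too high\<close>
    have full: "2 ^ k \<le> 4 * M\<^sup>2 * (norm z)\<^sup>2" if k: "k < K" "n k > 2 ^ k / 2" for k
    proof -
      have "n k / sqrt (2 ^ k) = norm (coeffs X (fst z) k *\<^sub>C X k)"
        using k nonneg by (simp add: z fst_sum_psi coeffs_finite_sum[OF B] mean norm_scaleC X norm_divide)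
      also have "\<dots> \<le> M * norm (fst z)" by (rule M(2))
      also have "\<dots> \<le> M * norm z" using M(1) norm_fst_le[of "fst z" "snd z"] by simp
      finally have 1: "n k / sqrt (2 ^ k) \<le> M * norm z" .
      have "sqrt (2 ^ k) = 2 * ((2 ^ k / 2) / sqrt (2 ^ k))" by (simp add: real_div_sqrt)
      also have "\<dots> \<le> 2 * (n k / sqrt (2 ^ k))" using k(2) by (intro mult_left_mono divide_right_mono) auto
      also have "\<dots> \<le> 2 * (M * norm z)" using 1 by simp
      finally have "(sqrt (2 ^ k))\<^sup>2 \<le> (2 * (M * norm z))\<^sup>2" by (rule power_mono) simp
      then show ?thesis by (simp add: power_mult_distrib)
    qed
    define G where "G = {k. k < K \<and> n k > 2 ^ k / 2}"
    have "real (card \<Lambda>) \<le> (\<Sum>k<K. 2 * (n k - (n k)\<^sup>2 / 2 ^ k) + (if k \<in> G then 2 ^ k else 0))"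
      unfolding card
    proof (intro sum_mono)
      fix k assume k: "k \<in> {..<K}"
      have sq: "(n k)\<^sup>2 / 2 ^ k \<le> n k"
        using mult_left_mono[OF nle nonneg, of k k] by (simp add: pos_divide_le_eq power2_eq_square)
      show "n k \<le> 2 * (n k - (n k)\<^sup>2 / 2 ^ k) + (if k \<in> G then 2 ^ k else 0)"
      proof (cases "k \<in> G")
        case True
        then show ?thesis using sq nle[of k] by simp
      next
        case False
        then have "n k \<le> 2 ^ k / 2" using k by (simp add: G_def)
        from mult_left_mono[OF this nonneg, of k] have "(n k)\<^sup>2 / 2 ^ k \<le> n k / 2"
          by (simp add: pos_divide_le_eq power2_eq_square)
        then have "n k \<le> 2 * (n k - (n k)\<^sup>2 / 2 ^ k)"
          by (simp only: right_diff_distrib le_diff_eq mult_2)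
        then show ?thesis by (simp only: False if_False add_0_right)
      qed
    qed
    also have "\<dots> = 2 * (norm (snd z))\<^sup>2 + (\<Sum>k\<in>G. 2 ^ k)"
    proof -
      have "(\<Sum>k<K. if k \<in> G then 2 ^ k else 0) = (\<Sum>k\<in>G. (2::real) ^ k)"
        by (intro sum.mono_neutral_cong_right) (auto simp: G_def)
      then show ?thesis by (simp only: snd sum.distrib sum_distrib_left)
    qed
    also have "(\<Sum>k\<in>G. 2 ^ k) \<le> 2 * (4 * M\<^sup>2 * (norm z)\<^sup>2)"
      by (rule sum_powers_of_two_le) (auto simp: G_def intro: full)
    also have "(norm (snd z))\<^sup>2 \<le> (norm z)\<^sup>2" by (simp add: norm_prod_power2[of z])
    finally show ?thesis by (simp add: C_def z_def algebra_simps)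
  qed
  have "1 / sqrt C * sqrt (real (card \<Lambda>)) \<le> norm (\<Sum>m\<in>\<Lambda>. psi X m)" if "finite \<Lambda>" for \<Lambda>
  proof -
    have "sqrt (real (card \<Lambda>)) \<le> sqrt (C * (norm (\<Sum>m\<in>\<Lambda>. psi X m))\<^sup>2)"
      using main[OF that] by simp
    also have "\<dots> = sqrt C * norm (\<Sum>m\<in>\<Lambda>. psi X m)" by (simp add: real_sqrt_mult)
    finally show ?thesis using C by (simp add: pos_divide_le_eq mult.commute)
  qed
  then show ?thesis using C by (intro that[of "1 / sqrt C"]) auto
qed


section \<open>Besselian and hilbertian bases\<close>

text \<open>
  Initial segments fit the block structure better than supports; the normalisation \<open>C \<ge> 1\<close> is
  convenient because the \<open>\<ell>\<^sup>2\<close> component satisfies the inequality with constant \<open>1\<close>.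
\<close>
lemma besselian_iff_initial_segments:
  "besselian e \<longleftrightarrow>
     (\<exists>C\<ge>1. \<forall>K a. (\<Sum>k<K. (cmod (a k))\<^sup>2) \<le> C * (norm (\<Sum>k<K. a k *\<^sub>C e k))\<^sup>2)"
proof
  assume "besselian e"
  then obtain C where C: "\<And>a. finite {j. a j \<noteq> 0} \<Longrightarrow>
        (\<Sum>j | a j \<noteq> 0. (cmod (a j))\<^sup>2) \<le> C * (norm (\<Sum>j | a j \<noteq> 0. a j *\<^sub>C e j))\<^sup>2"
    unfolding besselian_def by blast
  have "(\<Sum>k<K. (cmod (a k))\<^sup>2) \<le> max C 1 * (norm (\<Sum>k<K. a k *\<^sub>C e k))\<^sup>2" for K a
  proof -
    let ?a = "\<lambda>j. if j < K then a j else 0"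
    have sub: "{j. ?a j \<noteq> 0} \<subseteq> {..<K}" by auto
    have "(\<Sum>j | ?a j \<noteq> 0. (cmod (?a j))\<^sup>2) = (\<Sum>k<K. (cmod (a k))\<^sup>2)"
      using sub by (intro sum.mono_neutral_cong_left) auto
    moreover have "(\<Sum>j | ?a j \<noteq> 0. ?a j *\<^sub>C e j) = (\<Sum>k<K. a k *\<^sub>C e k)"
      using sub by (intro sum.mono_neutral_cong_left) auto
    moreover have "C * (norm (\<Sum>k<K. a k *\<^sub>C e k))\<^sup>2 \<le> max C 1 * (norm (\<Sum>k<K. a k *\<^sub>C e k))\<^sup>2"
      by (intro mult_right_mono) auto
    ultimately show ?thesis using C[of ?a] finite_subset[OF sub] by simp
  qed
  then show "\<exists>C\<ge>1. \<forall>K a. (\<Sum>k<K. (cmod (a k))\<^sup>2) \<le> C * (norm (\<Sum>k<K. a k *\<^sub>C e k))\<^sup>2"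
    by (intro exI[of _ "max C 1"]) auto
next
  assume "\<exists>C\<ge>1. \<forall>K a. (\<Sum>k<K. (cmod (a k))\<^sup>2) \<le> C * (norm (\<Sum>k<K. a k *\<^sub>C e k))\<^sup>2"
  then obtain C where C: "\<And>K a. (\<Sum>k<K. (cmod (a k))\<^sup>2) \<le> C * (norm (\<Sum>k<K. a k *\<^sub>C e k))\<^sup>2"
    by blast
  show "besselian e"
    unfolding besselian_def
  proof (intro exI[of _ C] allI impI)
    fix a :: "nat \<Rightarrow> complex" assume "finite {j. a j \<noteq> 0}"
    then obtain K where sub: "{j. a j \<noteq> 0} \<subseteq> {..<K}" using finite_nat_iff_bounded by blast
    have "(\<Sum>j | a j \<noteq> 0. (cmod (a j))\<^sup>2) = (\<Sum>k<K. (cmod (a k))\<^sup>2)"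
      using sub by (intro sum.mono_neutral_left) auto
    moreover have "(\<Sum>j | a j \<noteq> 0. a j *\<^sub>C e j) = (\<Sum>k<K. a k *\<^sub>C e k)"
      using sub by (intro sum.mono_neutral_left) auto
    ultimately show "(\<Sum>j | a j \<noteq> 0. (cmod (a j))\<^sup>2) \<le> C * (norm (\<Sum>j | a j \<noteq> 0. a j *\<^sub>C e j))\<^sup>2"
      using C by simp
  qed
qed

lemma hilbertian_iff_initial_segments:
  "hilbertian e \<longleftrightarrow>
     (\<exists>C>0. C \<le> 1 \<and> (\<forall>K a. C * (norm (\<Sum>k<K. a k *\<^sub>C e k))\<^sup>2 \<le> (\<Sum>k<K. (cmod (a k))\<^sup>2)))"
proof
  assume "hilbertian e"
  then obtain C where C: "C > 0" "\<And>a. finite {j. a j \<noteq> 0} \<Longrightarrow>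
        (\<Sum>j | a j \<noteq> 0. (cmod (a j))\<^sup>2) \<ge> C * (norm (\<Sum>j | a j \<noteq> 0. a j *\<^sub>C e j))\<^sup>2"
    unfolding hilbertian_def by blast
  have "min C 1 * (norm (\<Sum>k<K. a k *\<^sub>C e k))\<^sup>2 \<le> (\<Sum>k<K. (cmod (a k))\<^sup>2)" for K a
  proof -
    let ?a = "\<lambda>j. if j < K then a j else 0"
    have sub: "{j. ?a j \<noteq> 0} \<subseteq> {..<K}" by auto
    have "(\<Sum>j | ?a j \<noteq> 0. (cmod (?a j))\<^sup>2) = (\<Sum>k<K. (cmod (a k))\<^sup>2)"
      using sub by (intro sum.mono_neutral_cong_left) auto
    moreover have "(\<Sum>j | ?a j \<noteq> 0. ?a j *\<^sub>C e j) = (\<Sum>k<K. a k *\<^sub>C e k)"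
      using sub by (intro sum.mono_neutral_cong_left) auto
    moreover have "min C 1 * (norm (\<Sum>k<K. a k *\<^sub>C e k))\<^sup>2 \<le> C * (norm (\<Sum>k<K. a k *\<^sub>C e k))\<^sup>2"
      by (intro mult_right_mono) auto
    ultimately show ?thesis using C(2)[of ?a] finite_subset[OF sub] by simp
  qed
  then show "\<exists>C>0. C \<le> 1 \<and> (\<forall>K a. C * (norm (\<Sum>k<K. a k *\<^sub>C e k))\<^sup>2 \<le> (\<Sum>k<K. (cmod (a k))\<^sup>2))"
    using C(1) by (intro exI[of _ "min C 1"]) auto
next
  assume "\<exists>C>0. C \<le> 1 \<and> (\<forall>K a. C * (norm (\<Sum>k<K. a k *\<^sub>C e k))\<^sup>2 \<le> (\<Sum>k<K. (cmod (a k))\<^sup>2))"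
  then obtain C where C: "C > 0"
    "\<And>K a. C * (norm (\<Sum>k<K. a k *\<^sub>C e k))\<^sup>2 \<le> (\<Sum>k<K. (cmod (a k))\<^sup>2)"
    by blast
  show "hilbertian e"
    unfolding hilbertian_def
  proof (intro exI[of _ C] conjI allI impI C(1))
    fix a :: "nat \<Rightarrow> complex" assume "finite {j. a j \<noteq> 0}"
    then obtain K where sub: "{j. a j \<noteq> 0} \<subseteq> {..<K}" using finite_nat_iff_bounded by blast
    have "(\<Sum>j | a j \<noteq> 0. (cmod (a j))\<^sup>2) = (\<Sum>k<K. (cmod (a k))\<^sup>2)"
      using sub by (intro sum.mono_neutral_left) auto
    moreover have "(\<Sum>j | a j \<noteq> 0. a j *\<^sub>C e j) = (\<Sum>k<K. a k *\<^sub>C e k)"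
      using sub by (intro sum.mono_neutral_left) auto
    ultimately show "C * (norm (\<Sum>j | a j \<noteq> 0. a j *\<^sub>C e j))\<^sup>2 \<le> (\<Sum>j | a j \<noteq> 0. (cmod (a j))\<^sup>2)"
      using C by simp
  qed
qed

text \<open>
  The only difference from the \<open>\<ell>\<^sup>2\<close> norm of the coefficients is that the block means are measured
  in the first summand instead of in \<open>\<ell>\<^sup>2\<close>.  Thus inequalities between the norm of \<open>X\<close> and the
  \<open>\<ell>\<^sup>2\<close> norm of coefficients pass to \<open>psi X\<close>.
\<close>
lemma norm_sum_psi_power2:
  "(norm (\<Sum>m<first K. c m *\<^sub>C psi X m))\<^sup>2
     = (norm (\<Sum>k<K. block_mean c k *\<^sub>C X k))\<^sup>2
       + ((\<Sum>m<first K. (cmod (c m))\<^sup>2) - (\<Sum>k<K. (cmod (block_mean c k))\<^sup>2))"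
  by (simp add: norm_prod_power2[of "sum _ _"] fst_sum_psi norm_snd_sum_psi)

lemma sum_block_mean_le:
  "(\<Sum>k<K. (cmod (block_mean c k))\<^sup>2) \<le> (\<Sum>m<first K. (cmod (c m))\<^sup>2)"
proof -
  have "0 \<le> (norm (snd (\<Sum>m<first K. c m *\<^sub>C psi (\<lambda>_. 0 :: ell2) m)))\<^sup>2" by (rule zero_le_power2)
  then show ?thesis unfolding norm_snd_sum_psi by simp
qed

lemma sum_psi_up_to_level:
  "(\<Sum>m<n. c m *\<^sub>C psi X m) = (\<Sum>m<first n. (if m < n then c m else 0) *\<^sub>C psi X m)"
  "(\<Sum>m<n. (cmod (c m))\<^sup>2) = (\<Sum>m<first n. (cmod (if m < n then c m else 0))\<^sup>2)"
  using le_first[of n] by (auto intro!: sum.mono_neutral_cong_left split: if_splits)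

theorem besselian_psi:
  assumes "besselian X"
  shows "besselian (psi X)"
proof -
  obtain C where C: "C \<ge> 1" "\<And>K a. (\<Sum>k<K. (cmod (a k))\<^sup>2) \<le> C * (norm (\<Sum>k<K. a k *\<^sub>C X k))\<^sup>2"
    using assms unfolding besselian_iff_initial_segments by blast
  have main: "(\<Sum>m<first K. (cmod (c m))\<^sup>2) \<le> C * (norm (\<Sum>m<first K. c m *\<^sub>C psi X m))\<^sup>2" for K c
  proof -
    let ?d = "(\<Sum>m<first K. (cmod (c m))\<^sup>2) - (\<Sum>k<K. (cmod (block_mean c k))\<^sup>2)"
    have "?d \<le> C * ?d" using C(1) sum_block_mean_le[where K = K and c = c] mult_right_mono[of 1 C ?d] by simp
    then show ?thesis
      using C(2)[where K = K and a = "block_mean c"]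
      unfolding norm_sum_psi_power2 distrib_left by linarith
  qed
  have "(\<Sum>m<n. (cmod (c m))\<^sup>2) \<le> C * (norm (\<Sum>m<n. c m *\<^sub>C psi X m))\<^sup>2" for n c
    using main[of "\<lambda>m. if m < n then c m else 0" n]
    by (simp only: sum_psi_up_to_level(1)[where n = n and c = c]
        sum_psi_up_to_level(2)[where n = n and c = c])
  then show ?thesis
    unfolding besselian_iff_initial_segments using C(1) by blast
qed

theorem hilbertian_psi:
  assumes "hilbertian X"
  shows "hilbertian (psi X)"
proof -
  obtain C where C: "C > 0" "C \<le> 1"
    "\<And>K a. C * (norm (\<Sum>k<K. a k *\<^sub>C X k))\<^sup>2 \<le> (\<Sum>k<K. (cmod (a k))\<^sup>2)"
    using assms unfolding hilbertian_iff_initial_segments by blast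
  have main: "C * (norm (\<Sum>m<first K. c m *\<^sub>C psi X m))\<^sup>2 \<le> (\<Sum>m<first K. (cmod (c m))\<^sup>2)" for K c
  proof -
    let ?d = "(\<Sum>m<first K. (cmod (c m))\<^sup>2) - (\<Sum>k<K. (cmod (block_mean c k))\<^sup>2)"
    have "C * ?d \<le> ?d" using C(2) sum_block_mean_le[where K = K and c = c] mult_right_mono[of C 1 ?d] by simp
    then show ?thesis
      using C(3)[where K = K and a = "block_mean c"]
      unfolding norm_sum_psi_power2 distrib_left by linarith
  qed
  have "C * (norm (\<Sum>m<n. c m *\<^sub>C psi X m))\<^sup>2 \<le> (\<Sum>m<n. (cmod (c m))\<^sup>2)" for n c
    using main[of "\<lambda>m. if m < n then c m else 0" n]
    by (simp only: sum_psi_up_to_level(1)[where n = n and c = c]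
        sum_psi_up_to_level(2)[where n = n and c = c])
  then show ?thesis
    unfolding hilbertian_iff_initial_segments using C(1,2) by blast
qed


section \<open>Conditionality\<close>

text \<open>
  The coefficients of \<open>(x, 0)\<close> are constant in each block, so that complete blocks reproduce
  the terms of the expansion of \<open>x\<close>.
\<close>
lemma basis_proj_psi_blocks:
  assumes B: "schauder_basis X" and X: "\<And>k. norm (X k) = 1" and A: "finite A"
  shows "fst (basis_proj (psi X) (\<Union>k\<in>A. block k) (x, 0)) = basis_proj X A x"
proof -
  have fluct: "fluctuation 0 m = 0" for m by (simp add: fluctuation_def spread_zero)
  have "fst (psi_coeffs X (x, 0) m *\<^sub>C psi X m) = (coeffs X x k / of_nat (2 ^ k)) *\<^sub>C X k"
    if "m \<in> block k" for m k
  proof -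
    have "complex_of_real (sqrt (2 ^ k)) * complex_of_real (sqrt (2 ^ k)) = 2 ^ k"
      by (simp flip: of_real_mult)
    then show ?thesis
      using that by (simp add: psi_coeffs_split fluct psi_def scaleC_prod_def scaleC_scaleC)
  qed
  then have "(\<Sum>m\<in>block k. fst (psi_coeffs X (x, 0) m *\<^sub>C psi X m))
      = (\<Sum>m\<in>block k. (coeffs X x k / of_nat (2 ^ k)) *\<^sub>C X k)" for k
    by (intro sum.cong) auto
  also have "(\<Sum>m\<in>block k. (coeffs X x k / of_nat (2 ^ k)) *\<^sub>C X k) = coeffs X x k *\<^sub>C X k" for k
    by (simp flip: scaleC_sum_left)
  finally have blk: "(\<Sum>m\<in>block k. fst (psi_coeffs X (x, 0) m *\<^sub>C psi X m)) = coeffs X x k *\<^sub>C X k" for k .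
  have "fst (basis_proj (psi X) (\<Union>k\<in>A. block k) (x, 0))
      = (\<Sum>k\<in>A. \<Sum>m\<in>block k. fst (psi_coeffs X (x, 0) m *\<^sub>C psi X m))"
    unfolding basis_proj_def coeffs_psi[where X = X, OF B X] fst_sum
    by (rule sum.UNION_disjoint) (use A in auto)
  then show ?thesis by (simp add: blk basis_proj_def)
qed

lemma ratio_le_cond_const:
  assumes B: "schauder_basis e" and A: "finite A" "real (card A) \<le> t" and x: "x \<noteq> 0"
  shows "ereal (norm (basis_proj e A x) / norm x) \<le> cond_const e t"
proof -
  have "norm (basis_proj e A x) / norm x \<le> onorm (basis_proj e A)"
    using onorm[OF bounded_linear_basis_proj[OF B], of A x] x by (simp add: pos_divide_le_eq)
  then have "ereal (norm (basis_proj e A x) / norm x) \<le> ereal (onorm (basis_proj e A))" by simp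
  also have "\<dots> \<le> cond_const e t"
    unfolding cond_const_def using A by (intro SUP_upper) auto
  finally show ?thesis .
qed

lemma onorm_basis_proj_empty: "onorm (basis_proj e {}) = 0"
  by (simp add: basis_proj_def[abs_def] onorm_zero)

lemma cond_const_floor:
  assumes "t \<ge> 0"
  shows "cond_const e t = cond_const e (real (nat \<lfloor>t\<rfloor>))"
proof -
  have "real n \<le> t \<longleftrightarrow> real n \<le> real (nat \<lfloor>t\<rfloor>)" for n
    using assms by (simp only: of_nat_le_iff le_nat_iff zero_le_floor le_floor_iff of_int_of_nat_eq)
  then show ?thesis by (simp add: cond_const_def)
qed

text \<open>
  With \<open>L = \<lfloor>ln N\<rfloor>\<close>, the blocks below level \<open>L\<close> have fewer than \<open>2 ^ L \<le> exp L \<le> N\<close>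
  elements in total, so that a badly behaved projection along \<open>X\<close> on a subset of \<open>{..<L}\<close> is seen by
  \<open>cond_const (psi X) N\<close>.  The case \<open>L = 0\<close> is trivial because only the empty projection is left.
\<close>
theorem cond_const_psi_ge:
  assumes B: "schauder_basis X" and X: "\<And>k. norm (X k) = 1" and c: "c > 0" and N: "N \<ge> 1"
    and ex: "\<And>L. L \<ge> 1 \<Longrightarrow> \<exists>x A. x \<noteq> 0 \<and> A \<subseteq> {..<L} \<and>
        ereal (norm (basis_proj X A x)) \<ge> ereal c * cond_const X (real L) * ereal (norm x)"
  shows "ereal c * cond_const X (ln (real N)) \<le> cond_const (psi X) (real N)"
proof -
  define L where "L = nat \<lfloor>ln (real N)\<rfloor>"
  have cc: "cond_const X (ln (real N)) = cond_const X (real L)"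
    unfolding L_def using N by (intro cond_const_floor) simp
  show ?thesis
  proof (cases "L = 0")
    case True
    have "{A. finite A \<and> card A = 0} = {{} :: nat set}" by auto
    then have "cond_const X (real L) = 0"
      using True by (simp add: cond_const_def onorm_basis_proj_empty zero_ereal_def)
    moreover have "0 \<le> cond_const (psi X) (real N)"
      unfolding cond_const_def zero_ereal_def
      by (rule SUP_upper2[of "{}"]) (auto simp: onorm_basis_proj_empty)
    ultimately show ?thesis by (simp add: cc)
  next
    case False
    then obtain x A where x: "x \<noteq> 0" and A: "A \<subseteq> {..<L}" and
      ge: "ereal c * cond_const X (real L) * ereal (norm x) \<le> ereal (norm (basis_proj X A x))"
      using ex[of L] by auto
    have finA: "finite A" by (rule finite_subset[OF A]) simp
    define \<Lambda> where "\<Lambda> = (\<Union>k\<in>A. block k)"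
    have "\<Lambda> \<subseteq> {..<first L}" using A by (auto simp: \<Lambda>_def simp flip: level_less_iff)
    from card_mono[OF _ this] have "card \<Lambda> \<le> 2 ^ L" by (simp add: first_def)
    then have "real (card \<Lambda>) \<le> 2 ^ L" using of_nat_mono by fastforce
    also have "\<dots> \<le> exp 1 ^ L" using exp_ge_add_one_self[of 1] by (intro power_mono) auto
    also have "\<dots> = exp (real L)" by (simp flip: exp_of_nat_mult)
    also have "\<dots> \<le> exp (ln (real N))"
      unfolding exp_le_cancel_iff L_def using N by (intro of_nat_floor) simp
    also have "\<dots> = real N" using N by simp
    finally have card: "real (card \<Lambda>) \<le> real N" .
    have "norm (basis_proj X A x) \<le> norm (basis_proj (psi X) \<Lambda> (x, 0))"
      using norm_fst_le[of "fst (basis_proj (psi X) \<Lambda> (x, 0))" "snd (basis_proj (psi X) \<Lambda> (x, 0))"]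
      unfolding prod.collapse unfolding \<Lambda>_def basis_proj_psi_blocks[where X = X, OF B X finA] .
    then have le: "norm (basis_proj X A x) / norm x
        \<le> norm (basis_proj (psi X) \<Lambda> (x, 0)) / norm (x, 0 :: ell2)"
      by (simp add: norm_Pair divide_right_mono)
    have "ereal c * cond_const X (real L) \<le> ereal (norm (basis_proj X A x) / norm x)"
      using ge x c by (cases "cond_const X (real L)") (auto simp: pos_le_divide_eq)
    also have "\<dots> \<le> ereal (norm (basis_proj (psi X) \<Lambda> (x, 0)) / norm (x, 0 :: ell2))"
      using le by simp
    also have "\<dots> \<le> cond_const (psi X) (real N)"
      using x card finA
      by (intro ratio_le_cond_const schauder_basis_psi B X) (auto simp: \<Lambda>_def zero_prod_def)
    finally show ?thesis by (simp add: cc)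
  qed
qed

theorem theorem3p1:
  fixes X :: "nat \<Rightarrow> 'a::complex_banach"
  assumes "schauder_basis X"
    and "\<forall>k. norm (X k) = 1"
  shows "\<exists>\<Psi> :: nat \<Rightarrow> 'a \<times> ell2.
    schauder_basis \<Psi> \<and> quasi_greedy \<Psi> \<and>
    democratic \<Psi> \<and>
    (\<exists>c1 c2. 0 < c1 \<and> c1 \<le> c2 \<and>
       (\<forall>\<Lambda>. finite \<Lambda> \<longrightarrow>
          c1 * sqrt (real (card \<Lambda>)) \<le> norm (\<Sum>j\<in>\<Lambda>. \<Psi> j) \<and>
          norm (\<Sum>j\<in>\<Lambda>. \<Psi> j) \<le> c2 * sqrt (real (card \<Lambda>)))) \<and>
    (besselian X \<longrightarrow> besselian \<Psi>) \<and>
    (hilbertian X \<longrightarrow> hilbertian \<Psi>) \<and>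
    ((\<exists>c>0. \<forall>N\<ge>1. \<exists>x A. x \<noteq> 0 \<and> A \<subseteq> {..<N} \<and>
        ereal (norm (basis_proj X A x)) \<ge> ereal c * cond_const X (real N) * ereal (norm x)) \<longrightarrow>
     (\<exists>c'>0. \<forall>N\<ge>2. cond_const \<Psi> (real N) \<ge> ereal c' * cond_const X (ln (real N))))"
proof -
  have X: "norm (X k) = 1" for k using assms(2) by simp
  obtain c1 where c1: "0 < c1" "c1 \<le> 1"
    and lower: "\<And>\<Lambda>. finite \<Lambda> \<Longrightarrow> c1 * sqrt (real (card \<Lambda>)) \<le> norm (\<Sum>m\<in>\<Lambda>. psi X m)"
    using norm_sum_psi_indicator_ge[where X = X, OF assms(1) X] by blast
  note upper = norm_sum_psi_indicator_le[where X = X, OF X]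
  have "norm (\<Sum>j\<in>A. psi X j) \<le> 7 / c1 * norm (\<Sum>j\<in>B. psi X j)"
    if "finite A" "finite B" "card A = card B" for A B
  proof -
    have "norm (\<Sum>j\<in>A. psi X j) \<le> 7 / c1 * (c1 * sqrt (real (card B)))"
      using upper[OF that(1)] that(3) c1 by simp
    also have "\<dots> \<le> 7 / c1 * norm (\<Sum>j\<in>B. psi X j)"
      using lower[OF that(2)] c1 by (intro mult_left_mono) auto
    finally show ?thesis .
  qed
  then have "democratic (psi X)" unfolding democratic_def by blast
  moreover have "\<exists>c1 c2. 0 < c1 \<and> c1 \<le> c2 \<and>
       (\<forall>\<Lambda>. finite \<Lambda> \<longrightarrow>
          c1 * sqrt (real (card \<Lambda>)) \<le> norm (\<Sum>j\<in>\<Lambda>. psi X j) \<and>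
          norm (\<Sum>j\<in>\<Lambda>. psi X j) \<le> c2 * sqrt (real (card \<Lambda>)))"
  proof (rule exI[of _ c1], rule exI[of _ 7], intro conjI allI impI)
    show "c1 \<le> 7" using c1 by simp
  qed (rule c1 lower upper; assumption?)+
  moreover have "\<exists>c'>0. \<forall>N\<ge>2. cond_const (psi X) (real N) \<ge> ereal c' * cond_const X (ln (real N))"
    if cond: "\<exists>c>0. \<forall>N\<ge>1. \<exists>x A. x \<noteq> 0 \<and> A \<subseteq> {..<N} \<and>
        ereal (norm (basis_proj X A x)) \<ge> ereal c * cond_const X (real N) * ereal (norm x)"
  proof -
    obtain c where c: "c > 0" "\<And>N. N \<ge> 1 \<Longrightarrow> \<exists>x A. x \<noteq> 0 \<and> A \<subseteq> {..<N} \<and>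
        ereal (norm (basis_proj X A x)) \<ge> ereal c * cond_const X (real N) * ereal (norm x)"
      using cond by blast
    have "ereal c * cond_const X (ln (real N)) \<le> cond_const (psi X) (real N)" if "N \<ge> 2" for N
    proof (rule cond_const_psi_ge[where X = X, OF assms(1) X c(1)])
      show "N \<ge> 1" using that by simp
    qed (rule c(2))
    then show ?thesis using c(1) by blast
  qed
  ultimately show ?thesis
    using schauder_basis_psi[where X = X, OF assms(1) X] quasi_greedy_psi[where X = X, OF assms(1) X]
      besselian_psi[of X] hilbertian_psi[of X]
    by (intro exI[of _ "psi X"]) blast
qed

end
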